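(* Let $\alpha$ be the SUSY polycontact structure on $\mathbb{R}^{4|4}$, i.e. the vector-valued Grassmann odd one-form $$\alpha=\Big(dx^{\mu}+i\big(\theta^{a}(\sigma^{\mu})_{a}{}^{\dot b}\,d\bar\theta_{\dot b}+d\theta^{a}(\sigma^{\mu})_{a}{}^{\dot b}\,\bar\theta_{\dot b}\big)\Big)\frac{\partial}{\partial x^{\mu}},$$ and let $$\mathbb{D}_{a}=\frac{\partial}{\partial\theta^{a}}-i(\sigma^{\mu})_{a}{}^{\dot b}\bar\theta_{\dot b}\frac{\partial}{\partial x^{\mu}},\qquad \bar{\mathbb{D}}^{\dot a}=\frac{\partial}{\partial\bar\theta_{\dot a}}-i\,\theta^{b}(\sigma^{\mu})_{b}{}^{\dot a}\frac{\partial}{\partial x^{\mu}}$$ be the SUSY covariant derivatives. Then: 1. The kernel $\mathcal{D}:=\ker(\alpha)=\{X\in\mathrm{Vect}(\mathbb{R}^{4|4}) : i_X\alpha=0\}$ is precisely the SUSY structure, that is, $\mathcal{D}=\mathrm{Span}\{\mathbb{D}_a,\bar{\mathbb{D}}^{\dot a}\}$ (span over $C^\infty(\mathbb{R}^{4|4})$). 2. The exterior derivative $d\alpha$ is non-degenerate on the SUSY structure: for $X\in\mathcal{D}$, $i_X(d\alpha)=0$ if and only if $X=0$.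
   Context: $\mathbb{R}^{4|4}$ has global coordinates $(x^\mu,\theta^a,\bar\theta_{\dot a})$, $\mu\in\{0,1,2,3\}$, $a,\dot a\in\{1,2\}$; the $x^\mu$ are even (commuting), and $\theta^a,\bar\theta_{\dot a}$ are odd (anticommuting, including with each other). Functions are allowed complex coefficients ($i=\sqrt{-1}$). Repeated indices are summed. $\sigma^\mu=(\mathbf 1,\sigma^1,\sigma^2,\sigma^3)$ are the $2\times2$ identity and Pauli matrices, and $(\sigma^\mu)_a{}^{\dot b}$ is the entry in row $a$, column $\dot b$. $\mathrm{Vect}(\mathbb{R}^{4|4})$ is the module of vector fields (derivations of $C^\infty(\mathbb{R}^{4|4})$). Differential forms on a supermanifold $M$ with coordinates $x^A$ of parity $\widetilde A$ are functions on $\Pi TM$ with coordinates $(x^A,dx^A)$, where $dx^A$ has parity $\widetilde A+1$ (so here $dx^\mu$ is odd and $d\theta^a,d\bar\theta_{\dot a}$ are even); all these variables supercommute. A vector-valued form is $\Omega=\Omega^A(x,dx)\frac{\partial}{\partial x^A}$. Exterior derivative: $d\Omega=\big(dx^B\frac{\partial\Omega^A}{\partial x^B}\big)\frac{\partial}{\partial x^A}$. Interior derivative along a homogeneous vector field $X=X^B\frac{\partial}{\partial x^B}$ of parity $\widetilde X$: $i_X\Omega=\big((-1)^{\widetilde X}X^B\frac{\partial\Omega^A}{\partial dx^B}\big)\frac{\partial}{\partial x^A}$, extended additively to all $X$. (Left derivatives are used.) *)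

theory Defs
  imports "HOL-Analysis.Analysis" "HOL-Library.Z2"
begin

section \<open>Smooth functions\<close>

definition partial :: "'e \<Rightarrow> (real ^ 'e \<Rightarrow> complex) \<Rightarrow> real ^ 'e \<Rightarrow> complex"
  where "partial i f x = frechet_derivative f (at x) (axis i 1)"

primrec C_k :: "nat \<Rightarrow> (real ^ 'e \<Rightarrow> complex) \<Rightarrow> bool"
  where
    "C_k 0 f \<longleftrightarrow> continuous_on UNIV f"
  | "C_k (Suc k) f \<longleftrightarrow> (\<forall>x. f differentiable at x) \<and> (\<forall>i. C_k k (partial i f))"

definition smooth :: "(real ^ 'e \<Rightarrow> complex) \<Rightarrow> bool"
  where "smooth f \<longleftrightarrow> (\<forall>k. C_k k f)"

lemma partial_eq: "(f has_derivative f') (at x) \<Longrightarrow> partial i f x = f' (axis i 1)"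
  unfolding partial_def by (metis frechet_derivative_at)

lemma C_k_Suc_imp: "C_k (Suc k) f \<Longrightarrow> C_k k f"
proof (induction k arbitrary: f)
  case 0
  then show ?case
    by (auto intro!: continuous_at_imp_continuous_on differentiable_imp_continuous_within)
qed auto

lemma partial_const: "partial i (\<lambda>_. c) = (\<lambda>_. 0)"
  by (rule ext) (rule partial_eq, rule has_derivative_const)

lemma partial_add:
  assumes "\<forall>x. f differentiable at x" "\<forall>x. g differentiable at x"
  shows "partial i (\<lambda>x. f x + g x) = (\<lambda>x. partial i f x + partial i g x)"
proof
  fix x
  have "((\<lambda>x. f x + g x) has_derivative
      (\<lambda>h. frechet_derivative f (at x) h + frechet_derivative g (at x) h)) (at x)"
    using assms by (intro has_derivative_add) (auto simp: frechet_derivative_works)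
  from partial_eq[OF this] show "partial i (\<lambda>x. f x + g x) x = partial i f x + partial i g x"
    by (simp add: partial_def)
qed

lemma partial_mult:
  assumes "\<forall>x. f differentiable at x" "\<forall>x. g differentiable at x"
  shows "partial i (\<lambda>x. f x * g x) = (\<lambda>x. f x * partial i g x + partial i f x * g x)"
proof
  fix x
  have "((\<lambda>x. f x * g x) has_derivative
      (\<lambda>h. f x * frechet_derivative g (at x) h + frechet_derivative f (at x) h * g x)) (at x)"
    using assms by (intro has_derivative_mult) (auto simp: frechet_derivative_works)
  from partial_eq[OF this]
  show "partial i (\<lambda>x. f x * g x) x = f x * partial i g x + partial i f x * g x"
    by (simp add: partial_def)
qed

lemma C_k_const: "C_k k (\<lambda>_. c)"
  by (induction k arbitrary: c) (auto simp: partial_const)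

lemma C_k_add: "C_k k f \<Longrightarrow> C_k k g \<Longrightarrow> C_k k (\<lambda>x. f x + g x)"
  by (induction k arbitrary: f g)
    (auto simp: partial_add intro: continuous_on_add differentiable_add)

lemma C_k_mult: "C_k k f \<Longrightarrow> C_k k g \<Longrightarrow> C_k k (\<lambda>x. f x * g x)"
proof (induction k arbitrary: f g)
  case 0
  then show ?case by (auto intro: continuous_on_mult)
next
  case (Suc k)
  then have "C_k k f" "C_k k g" using C_k_Suc_imp by blast+
  with Suc show ?case
    by (auto simp: partial_mult intro!: C_k_add differentiable_mult)
qed

lemma smooth_const: "smooth (\<lambda>_. c)"
  by (simp add: smooth_def C_k_const)

lemma smooth_add: "smooth f \<Longrightarrow> smooth g \<Longrightarrow> smooth (\<lambda>x. f x + g x)"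
  by (simp add: smooth_def C_k_add)

lemma smooth_mult: "smooth f \<Longrightarrow> smooth g \<Longrightarrow> smooth (\<lambda>x. f x * g x)"
  by (simp add: smooth_def C_k_mult)

lemma smooth_cmult: "smooth f \<Longrightarrow> smooth (\<lambda>x. c * f x)"
  by (rule smooth_mult[OF smooth_const])

lemma smooth_uminus: "smooth f \<Longrightarrow> smooth (\<lambda>x. - f x)"
  using smooth_cmult[of f "-1"] by simp

lemma smooth_sum: "(\<And>a. a \<in> A \<Longrightarrow> smooth (f a)) \<Longrightarrow> smooth (\<lambda>x. \<Sum>a\<in>A. f a x)"
  by (induction A rule: infinite_finite_induct) (auto intro: smooth_const smooth_add)

lemma smooth_partial: "smooth f \<Longrightarrow> smooth (partial i f)"
  unfolding smooth_def by (metis C_k.simps(2))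

lemma smooth_coord: "smooth (\<lambda>x. complex_of_real (x $ i))"
proof -
  have hd: "((\<lambda>x. complex_of_real (x $ i)) has_derivative (\<lambda>h. complex_of_real (h $ i))) (at x)"
    for x :: "real ^ 'a"
    by (intro bounded_linear_imp_has_derivative bounded_linear_compose[OF bounded_linear_of_real]
        bounded_linear_vec_nth)
  have p: "partial j (\<lambda>x. complex_of_real (x $ i)) = (\<lambda>_. if j = i then 1 else 0)" for j :: 'a
    by (rule ext, subst partial_eq[OF hd]) (simp add: axis_def)
  have "C_k k (\<lambda>x. complex_of_real (x $ i))" for k
  proof (cases k)
    case 0
    then show ?thesis by (simp add: continuous_intros)
  next
    case (Suc n)
    then show ?thesis
      using hd by (auto simp: p C_k_const differentiable_def)
  qed
  then show ?thesis by (simp add: smooth_def)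
qed

definition proj_Inl :: "real ^ ('e::finite + 'o::finite) \<Rightarrow> real ^ 'e"
  where "proj_Inl z = (\<chi> i. z $ Inl i)"

lemma smooth_proj_Inl:
  fixes f :: "real ^ 'e \<Rightarrow> complex"
  assumes "smooth f"
  shows "smooth (\<lambda>z :: real ^ ('e + 'o::finite). f (proj_Inl z))"
proof -
  let ?P = "proj_Inl :: real ^ ('e + 'o) \<Rightarrow> real ^ 'e"
  have lin: "bounded_linear ?P"
    by (rule linear_conv_bounded_linear[THEN iffD1], rule linearI) (auto simp: proj_Inl_def vec_eq_iff)
  have hd: "((\<lambda>z. f (?P z)) has_derivative (\<lambda>h. frechet_derivative f (at (?P z)) (?P h))) (at z)"
    if "\<forall>x. f differentiable at x" for f :: "real ^ 'e \<Rightarrow> complex" and z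
    using diff_chain_at[OF bounded_linear_imp_has_derivative[OF lin], of f _ z] that
    by (auto simp: frechet_derivative_works o_def)
  have "C_k k f \<Longrightarrow> C_k k (\<lambda>z. f (?P z))" for k and f :: "real ^ 'e \<Rightarrow> complex"
  proof (induction k arbitrary: f)
    case 0
    then show ?case
      using continuous_on_compose2[OF _ linear_continuous_on[OF lin], of UNIV f UNIV] by simp
  next
    case (Suc k)
    have d: "\<forall>x. f differentiable at x" using Suc.prems by simp
    have ax: "?P (axis i 1) = (case i of Inl j \<Rightarrow> axis j 1 | Inr _ \<Rightarrow> 0)" for i
      by (cases i) (auto simp: proj_Inl_def axis_def vec_eq_iff)
    have fd0: "frechet_derivative f (at x) 0 = 0" for x
      using d linear_0 linear_frechet_derivative by blast
    have "partial i (\<lambda>z. f (?P z)) =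
        (case i of Inl j \<Rightarrow> (\<lambda>z. partial j f (?P z)) | Inr _ \<Rightarrow> (\<lambda>_. 0))" for i
      by (rule ext, subst partial_eq[OF hd[OF d]])
        (auto simp: ax partial_def fd0 split: sum.splits)
    moreover have "(\<lambda>z. f (?P z)) differentiable at z" for z
      using hd[OF d] by (auto simp: differentiable_def)
    ultimately show ?case
      using Suc by (auto simp: C_k_const split: sum.splits)
  qed
  with assms show ?thesis by (simp add: smooth_def)
qed


section \<open>The algebra of functions on a superdomain\<close>

text \<open>
  A linear order on the odd generators is only needed to fix the monomial basis
  \<open>\<xi>\<^sub>S = \<Prod>\<^sub>i\<^sub>\<in>\<^sub>S \<xi>\<^sub>i\<close> (increasing product). For generators indexed by a sum
  type, those of the left summand come first.
\<close>

instantiation sum :: (linorder, linorder) linorder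
begin

definition less_eq_sum :: "'a + 'b \<Rightarrow> 'a + 'b \<Rightarrow> bool"
  where "less_eq_sum x y = (case x of
      Inl a \<Rightarrow> (case y of Inl b \<Rightarrow> a \<le> b | Inr _ \<Rightarrow> True)
    | Inr a \<Rightarrow> (case y of Inl _ \<Rightarrow> False | Inr b \<Rightarrow> a \<le> b))"

definition less_sum :: "'a + 'b \<Rightarrow> 'a + 'b \<Rightarrow> bool"
  where "less_sum x y \<longleftrightarrow> x \<le> y \<and> \<not> y \<le> x"

instance
  by standard (auto simp: less_eq_sum_def less_sum_def split: sum.splits)

end

definition shuffle_sign :: "'o::linorder set \<Rightarrow> 'o set \<Rightarrow> complex"
  where "shuffle_sign A B = (-1) ^ card {(a, b). a \<in> A \<and> b \<in> B \<and> b < a}"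

text \<open>
  \<open>f :: 'o set \<Rightarrow> complex\<close> stands for the Grassmann algebra element \<open>\<Sum>\<^sub>S f S \<xi>\<^sub>S\<close>; for disjoint
  \<open>A\<close> and \<open>B\<close>, \<open>\<xi>\<^sub>A \<xi>\<^sub>B = shuffle_sign A B \<xi>\<^sub>A\<^sub>\<union>\<^sub>B\<close>.
\<close>

definition gmult :: "('o::linorder set \<Rightarrow> complex) \<Rightarrow> ('o set \<Rightarrow> complex) \<Rightarrow> 'o set \<Rightarrow> complex"
  where "gmult f g S = (\<Sum>T\<in>Pow S. shuffle_sign T (S - T) * (f T * g (S - T)))"

lemma shuffle_sign_Un_left:
  fixes A :: "'o::{finite,linorder} set"
  assumes "A \<inter> B = {}"
  shows "shuffle_sign (A \<union> B) C = shuffle_sign A C * shuffle_sign B C"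
proof -
  have "{(a, b). a \<in> A \<union> B \<and> b \<in> C \<and> b < a} =
      {(a, b). a \<in> A \<and> b \<in> C \<and> b < a} \<union> {(a, b). a \<in> B \<and> b \<in> C \<and> b < a}" by auto
  then show ?thesis using assms unfolding shuffle_sign_def
    by (simp add: card_Un_disjoint disjoint_iff power_add[symmetric])
qed

lemma shuffle_sign_Un_right:
  fixes A :: "'o::{finite,linorder} set"
  assumes "B \<inter> C = {}"
  shows "shuffle_sign A (B \<union> C) = shuffle_sign A B * shuffle_sign A C"
proof -
  have "{(a, b). a \<in> A \<and> b \<in> B \<union> C \<and> b < a} =
      {(a, b). a \<in> A \<and> b \<in> B \<and> b < a} \<union> {(a, b). a \<in> A \<and> b \<in> C \<and> b < a}" by auto
  then show ?thesis using assms unfolding shuffle_sign_def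
    by (simp add: card_Un_disjoint disjoint_iff power_add[symmetric])
qed

lemma gmult_assoc:
  fixes f g h :: "'o::{finite,linorder} set \<Rightarrow> complex"
  shows "gmult (gmult f g) h = gmult f (gmult g h)"
proof
  fix S :: "'o set"
  have "gmult (gmult f g) h S = (\<Sum>(U, T)\<in>Sigma (Pow S) Pow.
      shuffle_sign U (S - U) * (shuffle_sign T (U - T) * (f T * g (U - T))) * h (S - U))"
    by (simp add: gmult_def sum_distrib_left sum_distrib_right sum.Sigma mult.assoc)
  also have "\<dots> = (\<Sum>(T, V)\<in>Sigma (Pow S) (\<lambda>T. Pow (S - T)).
      shuffle_sign T (S - T) * (f T * (shuffle_sign V (S - T - V) * (g V * h (S - T - V)))))"
  proof (rule sum.reindex_bij_witness[where i = "\<lambda>(T, V). (T \<union> V, T)" and j = "\<lambda>(U, T). (T, U - T)"],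
      goal_cases)
    case (5 p)
    then obtain U T where p: "p = (U, T)" and UT: "U \<subseteq> S" "T \<subseteq> U" by auto
    have e: "S - T - (U - T) = S - U" "T \<union> (U - T) = U" "S - T = (U - T) \<union> (S - U)"
      using UT by auto
    have s1: "shuffle_sign U (S - U) = shuffle_sign T (S - U) * shuffle_sign (U - T) (S - U)"
      using shuffle_sign_Un_left[of T "U - T" "S - U"] e by auto
    have s2: "shuffle_sign T (S - T) = shuffle_sign T (U - T) * shuffle_sign T (S - U)"
      unfolding e(3) by (rule shuffle_sign_Un_right) auto
    show ?case unfolding p by (simp add: e(1) s1 s2)
  qed auto
  also have "\<dots> = gmult f (gmult g h) S"
    by (simp add: gmult_def sum_distrib_left sum.Sigma)
  finally show "gmult (gmult f g) h S = gmult f (gmult g h) S" .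
qed

definition gone :: "'o set \<Rightarrow> complex"
  where "gone S = (if S = {} then 1 else 0)"

lemma gmult_one_left: "gmult gone f = (f :: 'o::{finite,linorder} set \<Rightarrow> complex)"
proof
  fix S :: "'o set"
  have "gmult gone f S = (\<Sum>T\<in>Pow S. if T = {} then f S else 0)"
    unfolding gmult_def by (rule sum.cong) (auto simp: gone_def shuffle_sign_def)
  then show "gmult gone f S = f S" by simp
qed

lemma gmult_one_right: "gmult f gone = (f :: 'o::{finite,linorder} set \<Rightarrow> complex)"
proof
  fix S :: "'o set"
  have "gmult f gone S = (\<Sum>T\<in>Pow S. if T = S then f S else 0)"
    unfolding gmult_def
  proof (rule sum.cong, goal_cases)
    case (2 T)
    then have "S - T = {} \<longleftrightarrow> T = S" by auto
    then show ?case by (cases "T = S") (simp_all add: gone_def shuffle_sign_def)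
  qed simp
  then show "gmult f gone S = f S" by simp
qed

text \<open>
  \<open>('e, 'o) superfun\<close> is \<open>C\<^sup>\<infinity>(\<real>\<^sup>p\<^sup>|\<^sup>q)\<close> with complex coefficients, where \<open>'e\<close> indexes the \<open>p\<close> even
  and \<open>'o\<close> the \<open>q\<close> odd coordinates.
\<close>

typedef ('e, 'o) superfun =
  "{f :: real ^ 'e \<Rightarrow> 'o::{finite,linorder} set \<Rightarrow> complex. \<forall>S. smooth (\<lambda>x. f x S)}"
  by (rule exI[of _ "\<lambda>_ _. 0"]) (simp add: smooth_const)

setup_lifting type_definition_superfun

instantiation superfun :: (finite, "{finite,linorder}") ring_1
begin

lift_definition zero_superfun :: "('a, 'b) superfun" is "\<lambda>_ _. 0"
  by (rule smooth_const)

lift_definition one_superfun :: "('a, 'b) superfun" is "\<lambda>_. gone"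
  by (rule smooth_const)

lift_definition plus_superfun :: "('a, 'b) superfun \<Rightarrow> ('a, 'b) superfun \<Rightarrow> ('a, 'b) superfun"
  is "\<lambda>f g x S. f x S + g x S"
  by (intro smooth_add) auto

lift_definition uminus_superfun :: "('a, 'b) superfun \<Rightarrow> ('a, 'b) superfun"
  is "\<lambda>f x S. - f x S"
  by (intro smooth_uminus) auto

definition minus_superfun :: "('a, 'b) superfun \<Rightarrow> ('a, 'b) superfun \<Rightarrow> ('a, 'b) superfun"
  where "minus_superfun f g = f + - g"

lift_definition times_superfun :: "('a, 'b) superfun \<Rightarrow> ('a, 'b) superfun \<Rightarrow> ('a, 'b) superfun"
  is "\<lambda>f g x. gmult (f x) (g x)"
  unfolding gmult_def by (intro smooth_sum smooth_cmult smooth_mult) auto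

instance
proof
  fix a b c :: "('a, 'b) superfun"
  show "a * b * c = a * (b * c)" by transfer (simp add: gmult_assoc)
  show "1 * a = a" by transfer (simp add: gmult_one_left)
  show "a * 1 = a" by transfer (simp add: gmult_one_right)
  show "a + b + c = a + (b + c)" by transfer (simp add: add.assoc)
  show "a + b = b + a" by transfer (simp add: add.commute)
  show "0 + a = a" by transfer simp
  show "- a + a = 0" by transfer simp
  show "a - b = a + - b" by (simp add: minus_superfun_def)
  show "(a + b) * c = a * c + b * c"
    by transfer (simp add: gmult_def fun_eq_iff algebra_simps sum.distrib)
  show "a * (b + c) = a * b + a * c"
    by transfer (simp add: gmult_def fun_eq_iff algebra_simps sum.distrib)
  show "(0 :: ('a, 'b) superfun) \<noteq> 1"
    by transfer (simp add: gone_def fun_eq_iff exI[of _ "{}"])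
qed

end

lift_definition const :: "complex \<Rightarrow> ('e::finite, 'o::{finite,linorder}) superfun"
  is "\<lambda>c _ S. if S = {} then c else 0"
  by (rule smooth_const)

lift_definition coord :: "'e + 'o \<Rightarrow> ('e::finite, 'o::{finite,linorder}) superfun"
  is "\<lambda>A x S. case A of
        Inl i \<Rightarrow> if S = {} then complex_of_real (x $ i) else 0
      | Inr a \<Rightarrow> if S = {a} then 1 else 0"
  subgoal for A S
    by (cases A; cases "S = {}"; cases "S = {projr A}") (auto simp: smooth_const smooth_coord)
  done

text \<open>Left derivatives.\<close>

lift_definition pdiff :: "'e + 'o \<Rightarrow> ('e::finite, 'o::{finite,linorder}) superfun \<Rightarrow> ('e, 'o) superfun"
  is "\<lambda>A f x S. case A of
        Inl i \<Rightarrow> partial i (\<lambda>y. f y S) x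
      | Inr a \<Rightarrow> if a \<in> S then 0 else (-1) ^ card {b \<in> S. b < a} * f x (insert a S)"
  subgoal for A f S
    by (cases A; cases "projr A \<in> S")
      (auto simp: smooth_const intro: smooth_partial[of "\<lambda>y. f y S", simplified] smooth_cmult)
  done


section \<open>Parity and vector fields\<close>

definition psign :: "bit \<Rightarrow> 'r::ring_1"
  where "psign p = (if p = 0 then 1 else -1)"

lift_definition part :: "bit \<Rightarrow> ('e::finite, 'o::{finite,linorder}) superfun \<Rightarrow> ('e, 'o) superfun"
  is "\<lambda>p f x S. if of_nat (card S) = p then f x S else 0"
  subgoal for p f S
    by (cases "of_nat (card S) = p") (simp_all add: smooth_const)
  done

definition homogeneous :: "bit \<Rightarrow> ('e::finite, 'o::{finite,linorder}) superfun \<Rightarrow> bool"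
  where "homogeneous p f \<longleftrightarrow> part p f = f"

type_synonym ('e, 'o) operator = "('e, 'o) superfun \<Rightarrow> ('e, 'o) superfun"

text \<open>Derivations of parity \<open>p\<close>, linear over the complex numbers.\<close>

definition derivation :: "bit \<Rightarrow> ('e::finite, 'o::{finite,linorder}) operator \<Rightarrow> bool"
  where "derivation p X \<longleftrightarrow>
    (\<forall>f g. X (f + g) = X f + X g) \<and>
    (\<forall>c f. X (const c * f) = const c * X f) \<and>
    (\<forall>q f. homogeneous q f \<longrightarrow> homogeneous (p + q) (X f)) \<and>
    (\<forall>q f g. homogeneous q f \<longrightarrow> X (f * g) = X f * g + psign (p * q) * f * X g)"

definition Vect :: "('e::finite, 'o::{finite,linorder}) operator set"
  where "Vect = {X. \<exists>X0 X1. derivation 0 X0 \<and> derivation 1 X1 \<and> X = (\<lambda>f. X0 f + X1 f)}"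

text \<open>The parity \<open>p\<close> component of an operator; for \<open>X \<in> Vect\<close> as above it is \<open>X0\<close> or \<open>X1\<close>.\<close>

definition op_part :: "bit \<Rightarrow> ('e::finite, 'o::{finite,linorder}) operator \<Rightarrow> ('e, 'o) operator"
  where "op_part p X f = (\<Sum>q\<in>{0, 1}. part (p + q) (X (part q f)))"

text \<open>The span over the noncommutative ring of functions, acting by multiplication from the left.\<close>

definition left_span ::
    "('e::finite, 'o::{finite,linorder}) operator set \<Rightarrow> ('e, 'o) operator set"
  where "left_span B = {\<lambda>g. \<Sum>X\<in>F. c X * X g | c F. finite F \<and> F \<subseteq> B}"


section \<open>Differential forms\<close>

text \<open>
  On \<open>\<Pi>TM\<close> the even coordinates are the even \<open>x\<^sup>A\<close> and the \<open>dx\<^sup>A\<close> with \<open>x\<^sup>A\<close> odd; the odd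
  coordinates are the odd \<open>x\<^sup>A\<close> and the \<open>dx\<^sup>A\<close> with \<open>x\<^sup>A\<close> even.
\<close>

type_synonym ('e, 'o) form = "('e + 'o, 'o + 'e) superfun"

type_synonym ('e, 'o) vector_form = "'e + 'o \<Rightarrow> ('e, 'o) form"

definition base_ix :: "'e + 'o \<Rightarrow> ('e + 'o) + ('o + 'e)"
  where "base_ix A = (case A of Inl i \<Rightarrow> Inl (Inl i) | Inr a \<Rightarrow> Inr (Inl a))"

definition diff_ix :: "'e + 'o \<Rightarrow> ('e + 'o) + ('o + 'e)"
  where "diff_ix A = (case A of Inl i \<Rightarrow> Inr (Inr i) | Inr a \<Rightarrow> Inl (Inr a))"

text \<open>Functions on \<open>M\<close> as functions on \<open>\<Pi>TM\<close> not depending on the \<open>dx\<^sup>A\<close>.\<close>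

lift_definition pull ::
    "('e, 'o) superfun \<Rightarrow> ('e::{finite,linorder}, 'o::{finite,linorder}) form"
  is "\<lambda>f z S. if S \<subseteq> range Inl then f (proj_Inl z) (Inl -` S) else 0"
  subgoal for f S
    using smooth_proj_Inl[of "\<lambda>x. f x (Inl -` S)"]
    by (cases "S \<subseteq> range Inl") (simp_all add: smooth_const)
  done

definition ext_deriv ::
    "('e::{finite,linorder}, 'o::{finite,linorder}) vector_form \<Rightarrow>
      ('e, 'o) vector_form"
  where "ext_deriv \<Omega> = (\<lambda>A. \<Sum>B\<in>UNIV. coord (diff_ix B) * pdiff (base_ix B) (\<Omega> A))"

text \<open>The coefficients of a vector field \<open>X = X\<^sup>B \<partial>/\<partial>x\<^sup>B\<close> are \<open>X\<^sup>B = X (x\<^sup>B)\<close>.\<close>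

definition int_deriv_hom ::
    "bit \<Rightarrow> ('e::{finite,linorder}, 'o::{finite,linorder}) operator \<Rightarrow>
      ('e, 'o) vector_form \<Rightarrow> ('e, 'o) vector_form"
  where "int_deriv_hom p X \<Omega> =
    (\<lambda>A. \<Sum>B\<in>UNIV. psign p * pull (X (coord B)) * pdiff (diff_ix B) (\<Omega> A))"

definition int_deriv ::
    "('e::{finite,linorder}, 'o::{finite,linorder}) operator \<Rightarrow>
      ('e, 'o) vector_form \<Rightarrow> ('e, 'o) vector_form"
  where "int_deriv X \<Omega> = (\<lambda>A. \<Sum>p\<in>{0, 1}. int_deriv_hom p (op_part p X) \<Omega> A)"

definition form_kernel ::
    "('e::{finite,linorder}, 'o::{finite,linorder}) vector_form \<Rightarrow> ('e, 'o) operator set"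
  where "form_kernel \<Omega> = {X \<in> Vect. int_deriv X \<Omega> = (\<lambda>A. 0)}"


section \<open>The SUSY structure\<close>

text \<open>
  The numerals of type \<open>2\<close> and \<open>4\<close> are taken modulo 2 and 4. So \<open>\<theta>\<^sup>a\<close> and \<open>\<theta>bar\<^sub>a\<close> have
  \<open>a \<in> {1, 2}\<close>, as matrix indices do, and \<open>x\<^sup>\<mu>\<close> has \<open>\<mu> \<in> {0, 1, 2, 3}\<close>.
\<close>

abbreviation x_ix :: "4 \<Rightarrow> 4 + (2 + 2)" where "x_ix \<mu> \<equiv> Inl \<mu>"
abbreviation th_ix :: "2 \<Rightarrow> 4 + (2 + 2)" where "th_ix a \<equiv> Inr (Inl a)"
abbreviation thbar_ix :: "2 \<Rightarrow> 4 + (2 + 2)" where "thbar_ix a \<equiv> Inr (Inr a)"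

definition sigma :: "4 \<Rightarrow> complex ^ 2 ^ 2"
  where "sigma \<mu> =
    (if \<mu> = 0 then mat 1
     else if \<mu> = 1 then vector [vector [0, 1], vector [1, 0]]
     else if \<mu> = 2 then vector [vector [0, - \<i>], vector [\<i>, 0]]
     else vector [vector [1, 0], vector [0, -1]])"

definition alpha :: "(4, 2 + 2) vector_form"
  where "alpha = (\<lambda>A. case A of
      Inl \<mu> \<Rightarrow> coord (diff_ix (x_ix \<mu>)) + const \<i> * (\<Sum>a\<in>UNIV. \<Sum>b\<in>UNIV.
          coord (base_ix (th_ix a)) * const (sigma \<mu> $ a $ b) * coord (diff_ix (thbar_ix b))
        + coord (diff_ix (th_ix a)) * const (sigma \<mu> $ a $ b) * coord (base_ix (thbar_ix b)))
    | Inr _ \<Rightarrow> 0)"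

definition susy_D :: "2 \<Rightarrow> (4, 2 + 2) operator"
  where "susy_D a f = pdiff (th_ix a) f
    - (\<Sum>\<mu>\<in>UNIV. \<Sum>b\<in>UNIV.
        const \<i> * const (sigma \<mu> $ a $ b) * coord (thbar_ix b) * pdiff (x_ix \<mu>) f)"

definition susy_Dbar :: "2 \<Rightarrow> (4, 2 + 2) operator"
  where "susy_Dbar a f = pdiff (thbar_ix a) f
    - (\<Sum>\<mu>\<in>UNIV. \<Sum>b\<in>UNIV.
        const \<i> * coord (th_ix b) * const (sigma \<mu> $ b $ a) * pdiff (x_ix \<mu>) f)"

end

theory Submission
  imports Defs
begin

text \<open>
  A derivation is determined by its values on the coordinates: it kills constants, it is
  determined on monomials in the odd coordinates by the Leibniz rule, and on smooth functions of
  the even coordinates by Hadamard's lemma. Contracting \<open>\<alpha>\<close> with a homogeneous \<open>X\<close> gives, up to sign,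
  \<open>X(x\<^sup>\<mu>) + X(\<theta>\<^sup>a) V\<^sup>\<mu>\<^sub>a + X(\<theta>bar\<^sub>a) U\<^sup>\<mu>\<^sup>a\<close> with the same \<open>U\<close>, \<open>V\<close> as in
  \<open>D\<^sub>a = \<partial>/\<partial>\<theta>\<^sup>a - V\<^sup>\<mu>\<^sub>a \<partial>/\<partial>x\<^sup>\<mu>\<close> and \<open>Dbar\<^sup>a = \<partial>/\<partial>\<theta>bar\<^sub>a - U\<^sup>\<mu>\<^sup>a \<partial>/\<partial>x\<^sup>\<mu>\<close>. So \<open>X\<close> lies in the kernel iff
  \<open>X = X(\<theta>\<^sup>a) D\<^sub>a + X(\<theta>bar\<^sub>a) Dbar\<^sup>a\<close>. The parities of the two homogeneous parts keep their
  contractions from cancelling. Since \<open>\<sigma>\<^sup>0 = 1\<close>, the time component of \<open>d\<alpha>\<close> is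
  \<open>2i d\<theta>\<^sup>a d\<theta>bar\<^sub>a\<close>, whose contraction with \<open>X\<close> has the \<open>X(\<theta>\<^sup>a)\<close> and \<open>X(\<theta>bar\<^sub>a)\<close> as its coefficients;
  if it vanishes, so does \<open>X\<close>.
\<close>

section \<open>Hadamard's lemma\<close>

lemma smooth_differentiable: "smooth f \<Longrightarrow> f differentiable at x"
  unfolding smooth_def by (metis C_k.simps(2))

lemma differentiable_has_derivative_partial:
  fixes f :: "real ^ 'e \<Rightarrow> complex"
  assumes "f differentiable at x"
  shows "(f has_derivative (\<lambda>h. \<Sum>i\<in>UNIV. h $ i *\<^sub>R partial i f x)) (at x)"
proof -
  let ?D = "frechet_derivative f (at x)"
  have D: "(f has_derivative ?D) (at x)"
    using assms by (simp add: frechet_derivative_works)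
  then have "linear ?D" by (rule has_derivative_linear)
  have "?D h = (\<Sum>i\<in>UNIV. h $ i *\<^sub>R partial i f x)" for h
  proof -
    have "?D h = ?D (\<Sum>i\<in>UNIV. h $ i *\<^sub>R axis i 1)"
      by (simp add: basis_expansion scalar_mult_eq_scaleR[symmetric])
    also have "\<dots> = (\<Sum>i\<in>UNIV. h $ i *\<^sub>R partial i f x)"
      by (simp add: linear_sum[OF \<open>linear ?D\<close>] linear_cmul[OF \<open>linear ?D\<close>] partial_def)
    finally show ?thesis .
  qed
  then have "?D = (\<lambda>h. \<Sum>i\<in>UNIV. h $ i *\<^sub>R partial i f x)" by auto
  with D show ?thesis by simp
qed

lemma C_k_continuous: "C_k k f \<Longrightarrow> continuous_on UNIV f"
  by (induction k) (simp, blast dest: C_k_Suc_imp)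

text \<open>Differentiation under the integral sign needs the derivative to be continuous as a map
  into the bounded linear operators; its summands have this shape.\<close>

lemma continuous_on_blinfun_scaleR_left_compose:
  fixes L :: "'a::real_normed_vector \<Rightarrow>\<^sub>L real"
  assumes "continuous_on S g"
  shows "continuous_on S (\<lambda>z. blinfun_scaleR_left (g z) o\<^sub>L L)"
  by (intro bounded_bilinear.continuous_on[OF bounded_bilinear_blinfun_compose]
      bounded_linear.continuous_on[OF bounded_linear_blinfun_scaleR_left] continuous_on_const assms)

text \<open>The weight \<open>t ^ n\<close> makes the induction go through: differentiating
  \<open>f (p + t *\<^sub>R (x - p))\<close> in \<open>x\<close> brings out one factor
  \<open>t\<close>, so the partial derivatives are integrals of the same kind with \<open>n\<close>
  raised by one and \<open>f\<close> replaced by \<open>partial i f\<close>.\<close>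

lemma C_k_radial_integral:
  fixes f :: "real ^ 'e \<Rightarrow> complex"
  assumes "C_k k f"
  shows "C_k k (\<lambda>x. integral {0..1} (\<lambda>t. of_real (t ^ n) * f (p + t *\<^sub>R (x - p))))"
  using assms
proof (induction k arbitrary: f n)
  case 0
  then have c: "continuous_on UNIV f" by simp
  have "continuous_on UNIV
      (\<lambda>x. integral (cbox 0 1) (\<lambda>t. of_real (t ^ n) * f (p + t *\<^sub>R (x - p))))"
    by (rule integral_continuous_on_param)
      (auto simp: split_beta intro!: continuous_intros continuous_on_compose2[OF c])
  then show ?case by simp
next
  case (Suc k)
  then have d: "f differentiable at x" for x by simp
  have c: "continuous_on UNIV f" using Suc.prems C_k_continuous by blast
  have cp: "continuous_on UNIV (partial i f)" for i
    using Suc.prems C_k_continuous by (simp, blast)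
  \<comment> \<open>The total derivative of the integrand in \<open>x\<close>, packaged as a bounded
    linear map; the inner product with \<open>axis i 1\<close> is the i-th coordinate
    functional.\<close>
  let ?fx = "\<lambda>x t. \<Sum>i\<in>UNIV. 
      blinfun_scaleR_left (of_real (t ^ Suc n) * partial i f (p + t *\<^sub>R (x - p))) o\<^sub>L
      blinfun_inner_right (axis i (1 :: real))"
  let ?F = "\<lambda>x. integral (cbox 0 1) (\<lambda>t. of_real (t ^ n) * f (p + t *\<^sub>R (x - p)))"
  have app: "blinfun_apply (?fx x t) h =
      (\<Sum>i\<in>UNIV. h $ i *\<^sub>R (of_real (t ^ Suc n) * partial i f (p + t *\<^sub>R (x - p))))" for x t h
    by (simp add: blinfun.sum_left cart_eq_inner_axis inner_commute)
  have deriv: "(?F has_derivative blinfun_apply (integral (cbox 0 1) (?fx x))) (at x)" for x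
  proof (rule leibniz_rule[where U = UNIV and fx = ?fx and ?x0.0 = x
        and f = "\<lambda>x t. of_real (t ^ n) * f (p + t *\<^sub>R (x - p))"])
    fix x :: "real ^ 'e" and t :: real
    have "((\<lambda>x. p + t *\<^sub>R (x - p)) has_derivative (\<lambda>h. t *\<^sub>R h)) (at x)"
      by (auto intro!: derivative_eq_intros)
    from diff_chain_at[OF this differentiable_has_derivative_partial[OF d]]
    have "((\<lambda>x. f (p + t *\<^sub>R (x - p))) has_derivative
        (\<lambda>h. \<Sum>i\<in>UNIV. (t *\<^sub>R h) $ i *\<^sub>R partial i f (p + t *\<^sub>R (x - p)))) (at x)"
      by (simp add: o_def)
    from has_derivative_mult_right[OF this, of "of_real (t ^ n)"]
    show "((\<lambda>x. of_real (t ^ n) * f (p + t *\<^sub>R (x - p))) has_derivative blinfun_apply (?fx x t)) (at x)"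
      by (rule has_derivative_eq_rhs)
        (rule ext, simp only: app, simp add: sum_distrib_left scaleR_conv_of_real[where 'a = complex] mult_ac)
  next
    fix x :: "real ^ 'e"
    show "(\<lambda>t. of_real (t ^ n) * f (p + t *\<^sub>R (x - p))) integrable_on cbox 0 1"
      unfolding cbox_interval
      by (intro integrable_continuous_interval continuous_intros continuous_on_compose2[OF c]) auto
  next
    show "continuous_on (UNIV \<times> cbox 0 1) (\<lambda>(x, t). ?fx x t)"
      unfolding split_beta
      by (intro continuous_on_sum continuous_on_blinfun_scaleR_left_compose
          continuous_intros continuous_on_compose2[OF cp]) auto
  qed auto
  have int: "?fx x integrable_on cbox 0 1" for x
    unfolding cbox_interval
    by (intro integrable_continuous_interval continuous_on_sum continuous_on_blinfun_scaleR_left_compose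
          continuous_intros
        continuous_on_compose2[OF cp]) auto
  have part: "partial i ?F =
      (\<lambda>x. integral {0..1} (\<lambda>t. of_real (t ^ Suc n) * partial i f (p + t *\<^sub>R (x - p))))" for i
  proof
    fix x
    have "partial i ?F x = blinfun_apply (integral (cbox 0 1) (?fx x)) (axis i 1)"
      by (rule partial_eq[OF deriv])
    also have "\<dots> = integral (cbox 0 1) (\<lambda>t. blinfun_apply (?fx x t) (axis i 1))"
      by (rule blinfun_apply_integral[OF int])
    also have "(\<lambda>t. blinfun_apply (?fx x t) (axis i 1)) =
        (\<lambda>t. of_real (t ^ Suc n) * partial i f (p + t *\<^sub>R (x - p)))"
      by (rule ext, simp only: app) (simp add: axis_def if_distrib[of "\<lambda>c. c *\<^sub>R _"] cong: if_cong)
    finally show "partial i ?F x =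
        integral {0..1} (\<lambda>t. of_real (t ^ Suc n) * partial i f (p + t *\<^sub>R (x - p)))" by simp
  qed
  have "C_k (Suc k) ?F"
    unfolding C_k.simps part
  proof (intro conjI allI)
    show "?F differentiable at x" for x
      using deriv by (auto simp: differentiable_def)
    show "C_k k (\<lambda>x. integral {0..1} (\<lambda>t. of_real (t ^ Suc n) * partial i f (p + t *\<^sub>R (x - p))))" for i
      using Suc.prems by (intro Suc.IH) simp
  qed
  then show ?case by simp
qed

text \<open>Integrate the derivative of \<open>f\<close> along the segment from \<open>p\<close> to
  \<open>x\<close>. The chain rule yields the factors \<open>x $ i - p $ i\<close>, and the
  remaining integrals are smooth by \<open>C_k_radial_integral\<close> with
  \<open>n = 0\<close>.\<close>

lemma hadamard:
  fixes f :: "real ^ 'e \<Rightarrow> complex"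
  assumes f: "smooth f"
  obtains g where "\<And>i. smooth (g i)"
    "\<And>x. f x = f p + (\<Sum>i\<in>UNIV. of_real (x $ i - p $ i) * g i x)"
proof -
  define g where "g i x = integral {0..1} (\<lambda>t. partial i f (p + t *\<^sub>R (x - p)))" for i x
  have sg: "smooth (g i)" for i
    using C_k_radial_integral[of _ "partial i f" 0 p] smooth_partial[OF f, of i]
    unfolding smooth_def g_def by simp
  have cp: "continuous_on UNIV (partial i f)" for i
    using smooth_partial[OF f, of i] C_k_continuous unfolding smooth_def by blast
  have "f x = f p + (\<Sum>i\<in>UNIV. of_real (x $ i - p $ i) * g i x)" for x
  proof -
    let ?D = "\<lambda>t. \<Sum>i\<in>UNIV. of_real (x $ i - p $ i) * partial i f (p + t *\<^sub>R (x - p))"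
    have "((\<lambda>t. f (p + t *\<^sub>R (x - p))) has_vector_derivative ?D t) (at t within {0..1})" for t
    proof -
      have "((\<lambda>t. p + t *\<^sub>R (x - p)) has_derivative (\<lambda>h. h *\<^sub>R (x - p))) (at t)"
        by (auto intro!: derivative_eq_intros)
      from diff_chain_at[OF this differentiable_has_derivative_partial[OF smooth_differentiable[OF f]]]
      have "((\<lambda>t. f (p + t *\<^sub>R (x - p))) has_derivative
          (\<lambda>h. \<Sum>i\<in>UNIV. (h *\<^sub>R (x - p)) $ i *\<^sub>R partial i f (p + t *\<^sub>R (x - p)))) (at t)"
        unfolding o_def .
      moreover have "(\<lambda>h. \<Sum>i\<in>UNIV. (h *\<^sub>R (x - p)) $ i *\<^sub>R partial i f (p + t *\<^sub>R (x - p))) =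
          (\<lambda>h. h *\<^sub>R ?D t)"
        by (simp add: fun_eq_iff sum_distrib_left scaleR_conv_of_real[where 'a = complex] mult.assoc)
      ultimately show ?thesis
        unfolding has_vector_derivative_def by (simp add: has_derivative_at_withinI)
    qed
    then have "(?D has_integral (f (p + 1 *\<^sub>R (x - p)) - f (p + 0 *\<^sub>R (x - p)))) {0..1}"
      by (rule fundamental_theorem_of_calculus[OF zero_le_one])
    then have "f x - f p = integral {0..1} ?D"
      by (simp add: integral_unique)
    also have "\<dots> = (\<Sum>i\<in>UNIV. integral {0..1}
        (\<lambda>t. of_real (x $ i - p $ i) * partial i f (p + t *\<^sub>R (x - p))))"
      by (rule integral_sum; (intro integrable_continuous_interval continuous_intros
            continuous_on_compose2[OF cp])?) auto
    also have "\<dots> = (\<Sum>i\<in>UNIV. of_real (x $ i - p $ i) * g i x)"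
      unfolding g_def by (simp only: integral_mult_right)
    finally show ?thesis by (simp add: diff_eq_eq add.commute)
  qed
  with sg show thesis by (rule that)
qed

section \<open>Graded commutativity and the graded Leibniz rule\<close>

lemma of_nat_bit_eq: "(of_nat n :: bit) = (if even n then 0 else 1)"
  by (induction n) auto

lemma psign_of_nat: "psign (of_nat n) = (-1) ^ n"
  by (simp add: psign_def of_nat_bit_eq)

lemma psign_commute: "psign p * x = x * psign p"
  by (simp add: psign_def)

lemma psign_add: "psign (p + q) = psign p * psign q"
  by (cases p; cases q) (simp_all add: psign_def)

lemma shuffle_sign_self: "shuffle_sign A B * shuffle_sign A B = 1"
  unfolding shuffle_sign_def power_mult_distrib[symmetric] by simp

text \<open>As the sets are disjoint, each pair in \<open>A \<times> B\<close> is an inversion in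
  exactly one of the two orders, so the two inversion counts add up to
  \<open>card A * card B\<close>.\<close>

lemma shuffle_sign_commute:
  fixes A B :: "'o::{finite,linorder} set"
  assumes "A \<inter> B = {}"
  shows "shuffle_sign A B = (-1) ^ (card A * card B) * shuffle_sign B A"
proof -
  let ?P = "{(a, b). a \<in> A \<and> b \<in> B \<and> b < a}" and ?Q = "{(b, a). b \<in> B \<and> a \<in> A \<and> a < b}"
  have "A \<times> B = ?P \<union> prod.swap ` ?Q"
    using assms by (auto simp: image_iff split: prod.splits)
  moreover have "card (?P \<union> prod.swap ` ?Q) = card ?P + card (prod.swap ` ?Q)"
    by (rule card_Un_disjoint) auto
  ultimately have "card A * card B = card ?P + card (prod.swap ` ?Q)"
    by (metis card_cartesian_product)
  also have "card (prod.swap ` ?Q) = card ?Q"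
    by (intro card_image) auto
  finally have "(-1 :: complex) ^ (card A * card B) * (-1) ^ card ?Q = (-1) ^ card ?P * ((-1) ^ card ?Q * (-1) ^ card ?Q)"
    by (simp add: power_add)
  also have "(-1 :: complex) ^ card ?Q * (-1) ^ card ?Q = 1"
    by (simp flip: power_mult_distrib)
  finally show ?thesis by (simp add: shuffle_sign_def)
qed

lemma shuffle_sign_empty [simp]: "shuffle_sign {} B = 1" "shuffle_sign A {} = 1"
  by (simp_all add: shuffle_sign_def)

section \<open>Components of superfunctions\<close>

lemma superfun_eqI: "(\<And>x S. Rep_superfun f x S = Rep_superfun g x S) \<Longrightarrow> f = g"
  by (rule Rep_superfun_inject[THEN iffD1], rule ext, rule ext)

lemma smooth_Rep_superfun: "smooth (\<lambda>x. Rep_superfun f x S)"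
  using Rep_superfun[of f] unfolding mem_Collect_eq by blast

lemma Rep_superfun_minus: "Rep_superfun (f - g) x S = Rep_superfun f x S - Rep_superfun g x S"
  unfolding minus_superfun_def by (simp only: plus_superfun.rep_eq uminus_superfun.rep_eq diff_conv_add_uminus)

lemma Rep_superfun_sum: "Rep_superfun (\<Sum>i\<in>I. f i) x S = (\<Sum>i\<in>I. Rep_superfun (f i) x S)"
  by (induction I rule: infinite_finite_induct)
    (simp_all add: zero_superfun.rep_eq plus_superfun.rep_eq)

lemma Rep_superfun_psign_mult: "Rep_superfun (psign p * f) x S = psign p * Rep_superfun f x S"
  by (simp add: psign_def uminus_superfun.rep_eq)

text \<open>Only the summand \<open>T = {}\<close> survives, and its sign is 1. This covers
  constants, even coordinates and functions of the even coordinates as left factors.\<close>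

lemma gmult_body_left:
  fixes g :: "'o::{finite,linorder} set \<Rightarrow> complex"
  assumes "\<And>T. T \<noteq> {} \<Longrightarrow> f T = 0"
  shows "gmult f g S = f {} * g S"
proof -
  have "gmult f g S = (\<Sum>T\<in>Pow S. if T = {} then f {} * g S else 0)"
    unfolding gmult_def using assms by (intro sum.cong) auto
  then show ?thesis by simp
qed

lemma Rep_superfun_const_mult: "Rep_superfun (const c * f) x S = c * Rep_superfun f x S"
  by (simp add: times_superfun.rep_eq gmult_body_left const.rep_eq)

lemma Rep_superfun_even_coord_mult:
  "Rep_superfun (coord (Inl i) * f) x S = complex_of_real (x $ i) * Rep_superfun f x S"
  by (simp add: times_superfun.rep_eq gmult_body_left coord.rep_eq)

lemma const_mult: "const (c * d) = const c * const d"
  by (rule superfun_eqI) (simp add: Rep_superfun_const_mult const.rep_eq)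

lemma const_add: "const (c + d) = const c + const d"
  by (rule superfun_eqI) (simp add: const.rep_eq plus_superfun.rep_eq)

lemma const_0 [simp]: "const 0 = 0"
  by (rule superfun_eqI) (simp add: const.rep_eq zero_superfun.rep_eq)

lemma const_1 [simp]: "const 1 = 1"
  by (rule superfun_eqI) (simp add: const.rep_eq one_superfun.rep_eq gone_def)

section \<open>Parity and supercommutativity\<close>

lemma homogeneous_iff:
  "homogeneous p f \<longleftrightarrow> (\<forall>x S. of_nat (card S) \<noteq> p \<longrightarrow> Rep_superfun f x S = 0)"
proof
  show "homogeneous p f \<Longrightarrow> \<forall>x S. of_nat (card S) \<noteq> p \<longrightarrow> Rep_superfun f x S = 0"
    unfolding homogeneous_def by (metis part.rep_eq)
qed (auto simp: homogeneous_def part.rep_eq intro!: superfun_eqI)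

lemma homogeneousD: "homogeneous p f \<Longrightarrow> of_nat (card S) \<noteq> p \<Longrightarrow> Rep_superfun f x S = 0"
  by (simp add: homogeneous_iff)

lemma homogeneous_part: "homogeneous p (part p f)"
  by (simp add: homogeneous_iff part.rep_eq)

lemma part_homogeneous: "homogeneous q f \<Longrightarrow> part p f = (if p = q then f else 0)"
  by (auto simp: homogeneous_iff part.rep_eq zero_superfun.rep_eq intro!: superfun_eqI)

lemma part_add: "part p (f + g) = part p f + part p g"
  by (rule superfun_eqI) (simp add: part.rep_eq plus_superfun.rep_eq)

lemma sum_parts: "part 0 f + part 1 f = f"
  by (rule superfun_eqI) (simp add: part.rep_eq plus_superfun.rep_eq of_nat_bit_eq)

lemma homogeneous_0: "homogeneous p 0"
  by (simp add: homogeneous_iff zero_superfun.rep_eq)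

lemma homogeneous_add: "homogeneous p f \<Longrightarrow> homogeneous p g \<Longrightarrow> homogeneous p (f + g)"
  by (simp add: homogeneous_iff plus_superfun.rep_eq)

lemma homogeneous_uminus: "homogeneous p f \<Longrightarrow> homogeneous p (- f)"
  by (simp add: homogeneous_iff uminus_superfun.rep_eq)

lemma homogeneous_sum: "(\<And>i. i \<in> I \<Longrightarrow> homogeneous p (f i)) \<Longrightarrow> homogeneous p (\<Sum>i\<in>I. f i)"
  by (induction I rule: infinite_finite_induct) (auto intro: homogeneous_0 homogeneous_add)

lemma homogeneous_const: "homogeneous 0 (const c)"
  by (auto simp: homogeneous_iff const.rep_eq)

lemma homogeneous_1: "homogeneous 0 1"
  using homogeneous_const[of 1] by simp

lemma homogeneous_even_coord: "homogeneous 0 (coord (Inl i))"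
  by (auto simp: homogeneous_iff coord.rep_eq)

lemma homogeneous_odd_coord: "homogeneous 1 (coord (Inr a))"
  by (auto simp: homogeneous_iff coord.rep_eq)

lemma homogeneous_mult:
  assumes f: "homogeneous p f" and g: "homogeneous q g"
  shows "homogeneous (p + q) (f * g)"
proof -
  have "Rep_superfun (f * g) x S = 0" if "of_nat (card S) \<noteq> p + q" for x S
    unfolding times_superfun.rep_eq gmult_def
  proof (rule sum.neutral, rule ballI)
    fix T assume "T \<in> Pow S"
    then have "card S = card T + card (S - T)"
      by (metis PowD card_Diff_subset card_mono finite le_add_diff_inverse)
    with that have "of_nat (card T) \<noteq> p \<or> of_nat (card (S - T)) \<noteq> q" by auto
    then show "shuffle_sign T (S - T) * (Rep_superfun f x T * Rep_superfun g x (S - T)) = 0"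
      using homogeneousD[OF f] homogeneousD[OF g] by auto
  qed
  then show ?thesis by (simp add: homogeneous_iff)
qed

text \<open>Complementation in \<open>S\<close> exchanges the roles of the two factors. A term
  either vanishes by homogeneity or has card (S - T) of parity \<open>p\<close> and card T of parity
  \<open>q\<close>, and then \<open>shuffle_sign_commute\<close> gives the sign.\<close>

lemma supercommute:
  assumes f: "homogeneous p f" and g: "homogeneous q g"
  shows "f * g = psign (p * q) * (g * f)"
proof (rule superfun_eqI)
  fix x S
  let ?f = "Rep_superfun f x" and ?g = "Rep_superfun g x"
  have "Rep_superfun (f * g) x S = (\<Sum>T\<in>Pow S. shuffle_sign T (S - T) * (?f T * ?g (S - T)))"
    by (simp add: times_superfun.rep_eq gmult_def)
  also have "\<dots> = (\<Sum>T\<in>Pow S. shuffle_sign (S - T) T * (?f (S - T) * ?g T))"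
    by (rule sum.reindex_bij_witness[where i = "\<lambda>T. S - T" and j = "\<lambda>T. S - T"])
      (auto simp: double_diff)
  also have "\<dots> = (\<Sum>T\<in>Pow S. psign (p * q) * (shuffle_sign T (S - T) * (?g T * ?f (S - T))))"
  proof (rule sum.cong[OF refl])
    fix T
    show "shuffle_sign (S - T) T * (?f (S - T) * ?g T) =
        psign (p * q) * (shuffle_sign T (S - T) * (?g T * ?f (S - T)))"
    proof (cases "of_nat (card (S - T)) = p \<and> of_nat (card T) = q")
      case True
      then have "psign (p * q) = (-1 :: complex) ^ (card (S - T) * card T)"
        by (metis of_nat_mult psign_of_nat)
      then show ?thesis
        using shuffle_sign_commute[of "S - T" T] by auto
    next
      case False
      then show ?thesis using homogeneousD[OF f] homogeneousD[OF g] by auto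
    qed
  qed
  finally show "Rep_superfun (f * g) x S = Rep_superfun (psign (p * q) * (g * f)) x S"
    unfolding Rep_superfun_psign_mult
    by (simp add: times_superfun.rep_eq gmult_def sum_distrib_left)
qed

text \<open>Here \<open>g\<close> may be of mixed parity: both of its parts commute with
  \<open>f\<close> without a sign.\<close>

lemma even_commute:
  assumes "homogeneous 0 f"
  shows "f * g = g * f"
proof -
  have "f * part p g = part p g * f" for p
    using supercommute[OF assms homogeneous_part, of p g] by (simp add: psign_def)
  then have "f * (part 0 g + part 1 g) = (part 0 g + part 1 g) * f"
    by (simp add: algebra_simps)
  then show ?thesis by (simp add: sum_parts)
qed

lemma const_commute: "const c * f = f * const c"
  by (rule even_commute[OF homogeneous_const])

section \<open>Leibniz rule for even and odd partial derivatives\<close>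

lemma partial_cmult:
  assumes "smooth f" shows "partial i (\<lambda>x. c * f x) = (\<lambda>x. c * partial i f x)"
  using partial_mult[of "\<lambda>_. c" f i] smooth_differentiable[OF assms] by (simp add: partial_const)

lemma partial_sum:
  assumes "\<And>a. a \<in> A \<Longrightarrow> smooth (f a)"
  shows "partial i (\<lambda>x. \<Sum>a\<in>A. f a x) = (\<lambda>x. \<Sum>a\<in>A. partial i (f a) x)"
  using assms
proof (induction A rule: infinite_finite_induct)
  case (insert a A)
  then have "partial i (\<lambda>x. f a x + (\<Sum>a\<in>A. f a x)) =
      (\<lambda>x. partial i (f a) x + partial i (\<lambda>x. \<Sum>a\<in>A. f a x) x)"
    by (intro partial_add) (auto intro!: smooth_differentiable smooth_sum)
  with insert show ?case by simp
qed (simp_all add: partial_const)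

lemma pdiff_add: "pdiff A (f + g) = pdiff A f + pdiff A g"
proof (cases A)
  case (Inl i)
  have "partial i (\<lambda>x. Rep_superfun f x S + Rep_superfun g x S) =
      (\<lambda>x. partial i (\<lambda>x. Rep_superfun f x S) x + partial i (\<lambda>x. Rep_superfun g x S) x)" for S
    by (rule partial_add) (auto intro!: smooth_differentiable smooth_Rep_superfun)
  then show ?thesis
    using Inl by (auto intro!: superfun_eqI simp: pdiff.rep_eq plus_superfun.rep_eq)
qed (auto intro!: superfun_eqI simp: pdiff.rep_eq plus_superfun.rep_eq algebra_simps)

lemma pdiff_even_mult: "pdiff (Inl i) (f * g) = pdiff (Inl i) f * g + f * pdiff (Inl i) g"
proof (rule superfun_eqI)
  fix x S
  let ?f = "\<lambda>T y. Rep_superfun f y T" and ?g = "\<lambda>T y. Rep_superfun g y T"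
  have s: "smooth (?f T)" "smooth (?g T)" for T
    by (rule smooth_Rep_superfun)+
  have m: "partial i (\<lambda>y. ?f T y * ?g U y) = (\<lambda>y. ?f T y * partial i (?g U) y + partial i (?f T) y * ?g U y)"
    for T U
    by (rule partial_mult) (auto intro!: smooth_differentiable s)
  have "Rep_superfun (pdiff (Inl i) (f * g)) x S =
      partial i (\<lambda>y. \<Sum>T\<in>Pow S. shuffle_sign T (S - T) * (?f T y * ?g (S - T) y)) x"
    by (simp add: pdiff.rep_eq times_superfun.rep_eq gmult_def)
  also have "\<dots> = (\<Sum>T\<in>Pow S. shuffle_sign T (S - T) *
      (?f T x * partial i (?g (S - T)) x + partial i (?f T) x * ?g (S - T) x))"
    by (subst partial_sum) (simp_all add: partial_cmult smooth_mult smooth_cmult s m)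
  also have "\<dots> = Rep_superfun (pdiff (Inl i) f * g + f * pdiff (Inl i) g) x S"
    by (simp add: pdiff.rep_eq times_superfun.rep_eq plus_superfun.rep_eq gmult_def
        sum.distrib[symmetric] algebra_simps)
  finally show "Rep_superfun (pdiff (Inl i) (f * g)) x S =
      Rep_superfun (pdiff (Inl i) f * g + f * pdiff (Inl i) g) x S" .
qed

text \<open>The elements of \<open>S\<close> below \<open>a\<close> are the inversions of
  \<open>{a}\<close> against \<open>S\<close>, so the sign in \<open>pdiff\<close> is itself a
  shuffle sign and obeys the same rules as the signs of a product.\<close>

lemma Rep_superfun_pdiff_odd:
  "Rep_superfun (pdiff (Inr a) f) x S =
    (if a \<in> S then 0 else shuffle_sign {a} S * Rep_superfun f x (insert a S))"
proof -
  have "{(c, b). c \<in> {a} \<and> b \<in> S \<and> b < c} = Pair a ` {b \<in> S. b < a}" by auto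
  then have "card {(c, b). c \<in> {a} \<and> b \<in> S \<and> b < c} = card {b \<in> S. b < a}"
    by (simp add: card_image inj_on_def)
  then show ?thesis by (simp add: pdiff.rep_eq shuffle_sign_def)
qed

text \<open>Compare coefficients at \<open>S\<close>. If \<open>a\<close> lies in \<open>S\<close>,
  the two terms on the right cancel. Otherwise the product is summed over the subsets of
  \<open>insert a S\<close>: those containing \<open>a\<close> give the derivative of
  \<open>f\<close>, the others give the derivative of \<open>g\<close> with the sign of passing
  \<open>f\<close>.\<close>

lemma pdiff_odd_mult:
  assumes f: "homogeneous q f"
  shows "pdiff (Inr a) (f * g) = pdiff (Inr a) f * g + psign q * f * pdiff (Inr a) g"
proof (rule superfun_eqI)
  fix x and S :: "'b set"
  let ?f = "Rep_superfun f x" and ?g = "Rep_superfun g x"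
  \<comment> \<open>A nonzero coefficient of \<open>f\<close> at \<open>T\<close> forces
    \<open>card T\<close> to have parity \<open>q\<close>, so the global sign can be exchanged for
    one depending on \<open>T\<close>.\<close>
  have sq: "?f T * psign q = ?f T * (-1) ^ card T" for T
    using homogeneousD[OF f, of T x] psign_of_nat[of "card T", where 'a = complex] by auto
  have swap: "shuffle_sign T {a} * shuffle_sign {a} T = (-1) ^ card T" if "a \<notin> T" for T
    using shuffle_sign_commute[of T "{a}"] shuffle_sign_self[of "{a}" T] that by (simp add: mult.assoc)
  have ins: "shuffle_sign (insert a T) U = shuffle_sign {a} U * shuffle_sign T U"
    "shuffle_sign U (insert a T) = shuffle_sign U {a} * shuffle_sign U T" if "a \<notin> T" for T U
    using shuffle_sign_Un_left[of "{a}" T U] shuffle_sign_Un_right[of "{a}" T U] that by auto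
  \<comment> \<open>\<open>L\<close> and \<open>R\<close> are the coefficients of the two summands
    on the right, restricted to the terms in which the derivative does not vanish.\<close>
  define L where "L = (\<Sum>T\<in>{T\<in>Pow S. a \<notin> T}. shuffle_sign T (S - T) *
      (shuffle_sign {a} T * ?f (insert a T) * ?g (S - T)))"
  define R where "R = (\<Sum>T\<in>{T\<in>Pow S. a \<notin> S - T}. shuffle_sign T (S - T) *
      (psign q * ?f T * (shuffle_sign {a} (S - T) * ?g (insert a (S - T)))))"
  have "Rep_superfun (pdiff (Inr a) f * g) x S = L"
    unfolding times_superfun.rep_eq gmult_def L_def
    by (rule sum.mono_neutral_cong_right) (auto simp: Rep_superfun_pdiff_odd)
  moreover have "Rep_superfun (psign q * (f * pdiff (Inr a) g)) x S = R"
    unfolding Rep_superfun_psign_mult unfolding times_superfun.rep_eq gmult_def R_def sum_distrib_left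
    by (rule sum.mono_neutral_cong_right) (auto simp: Rep_superfun_pdiff_odd)
  ultimately have rhs: "Rep_superfun (pdiff (Inr a) f * g + psign q * f * pdiff (Inr a) g) x S = L + R"
    by (simp add: plus_superfun.rep_eq mult.assoc)
  show "Rep_superfun (pdiff (Inr a) (f * g)) x S =
      Rep_superfun (pdiff (Inr a) f * g + psign q * f * pdiff (Inr a) g) x S"
  proof (cases "a \<in> S")
    case True
    \<comment> \<open>The left-hand side vanishes, and the term of \<open>T\<close> in \<open>L\<close> cancels that of \<open>insert a T\<close> in \<open>R\<close>.\<close>
    have "L = (\<Sum>T\<in>{T\<in>Pow S. a \<notin> S - T}. shuffle_sign (T - {a}) (S - (T - {a})) *
      (shuffle_sign {a} (T - {a}) * ?f (insert a (T - {a})) * ?g (S - (T - {a}))))"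
      unfolding L_def using True
      by (intro sum.reindex_bij_witness[where i = "\<lambda>T. T - {a}" and j = "insert a"])
        (auto simp: insert_absorb)
    also have "\<dots> = - R"
      unfolding R_def sum_negf[symmetric]
    proof (rule sum.cong[OF refl])
      fix T assume "T \<in> {T\<in>Pow S. a \<notin> S - T}"
      with True have T: "T \<subseteq> S" "a \<in> T" by auto
      define U V where "U = T - {a}" and "V = S - T"
      have UV: "T = insert a U" "S - U = insert a V" "a \<notin> U" "a \<notin> V" "S - T = V" "T - {a} = U"
        using T by (auto simp: U_def V_def)
      have c: "card T = Suc (card U)" using UV(1,3) by simp
      have "shuffle_sign U (insert a V) * (shuffle_sign {a} U * ?f (insert a U) * ?g (insert a V)) =
          (shuffle_sign U {a} * shuffle_sign {a} U) * (shuffle_sign U V * (?f T * ?g (insert a V)))"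
        unfolding UV(1) by (simp only: ins[OF UV(4)] mult_ac)
      \<comment> \<open>The minus sign behind the cancellation: \<open>T\<close> has one element
        more than \<open>U\<close>.\<close>
      also have "\<dots> = - ((shuffle_sign {a} V * shuffle_sign {a} V) *
          (shuffle_sign U V * ((?f T * (-1) ^ card T) * ?g (insert a V))))"
        by (simp only: swap[OF UV(3)] c shuffle_sign_self) simp
      also have "\<dots> = - (shuffle_sign T V * (psign q * ?f T * (shuffle_sign {a} V * ?g (insert a V))))"
        unfolding sq[symmetric] UV(1) by (simp only: ins[OF UV(3)] mult_ac)
      finally show "shuffle_sign (T - {a}) (S - (T - {a})) *
          (shuffle_sign {a} (T - {a}) * ?f (insert a (T - {a})) * ?g (S - (T - {a}))) =
          - (shuffle_sign T (S - T) * (psign q * ?f T * (shuffle_sign {a} (S - T) * ?g (insert a (S - T)))))"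
        unfolding UV(6) UV(2,5) UV(1)[symmetric] .
    qed
    finally show ?thesis
      unfolding rhs using True by (simp add: Rep_superfun_pdiff_odd)
  next
    case False
    let ?h = "\<lambda>T. shuffle_sign {a} S * (shuffle_sign T (insert a S - T) * (?f T * ?g (insert a S - T)))"
    have e: "insert a S - T = insert a (S - T)" "insert a S - insert a T = S - T"
      "shuffle_sign {a} S = shuffle_sign {a} T * shuffle_sign {a} (S - T)" if "T \<subseteq> S" for T
      using that False shuffle_sign_Un_right[of T "S - T" "{a}"] by (auto simp: Un_absorb1)
    have "Rep_superfun (pdiff (Inr a) (f * g)) x S = (\<Sum>T\<in>Pow (insert a S). ?h T)"
      using False by (simp add: Rep_superfun_pdiff_odd times_superfun.rep_eq gmult_def sum_distrib_left)
    also have "\<dots> = (\<Sum>T\<in>Pow S. ?h T) + (\<Sum>T\<in>insert a ` Pow S. ?h T)"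
      unfolding Pow_insert using False by (intro sum.union_disjoint) auto
    also have "(\<Sum>T\<in>insert a ` Pow S. ?h T) = (\<Sum>T\<in>Pow S. ?h (insert a T))"
      using False by (intro sum.reindex_cong[where l = "insert a"]) (auto simp: inj_on_def)
    also have "\<dots> = L"
      unfolding L_def
    proof (intro sum.cong)
      fix T assume "T \<in> {T \<in> Pow S. a \<notin> T}"
      then have T: "T \<subseteq> S" "a \<notin> T" by auto
      have "?h (insert a T) = (shuffle_sign {a} (S - T) * shuffle_sign {a} (S - T)) *
          (shuffle_sign T (S - T) * (shuffle_sign {a} T * ?f (insert a T) * ?g (S - T)))"
        by (simp only: e[OF T(1)] ins(1)[OF T(2)] mult_ac)
      then show "?h (insert a T) = shuffle_sign T (S - T) * (shuffle_sign {a} T * ?f (insert a T) * ?g (S - T))"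
        by (simp add: shuffle_sign_self)
    qed (use False in auto)
    also have "(\<Sum>T\<in>Pow S. ?h T) = R"
      unfolding R_def
    proof (intro sum.cong)
      fix T assume "T \<in> {T \<in> Pow S. a \<notin> S - T}"
      then have T: "T \<subseteq> S" "a \<notin> T" "a \<notin> S - T" using False by auto
      have "?h T = (shuffle_sign T {a} * shuffle_sign {a} T) * (shuffle_sign T (S - T) *
          (?f T * (shuffle_sign {a} (S - T) * ?g (insert a (S - T)))))"
        by (simp only: e[OF T(1)] ins(2)[OF T(3)] mult_ac)
      also have "\<dots> = shuffle_sign T (S - T) *
          (?f T * (-1) ^ card T * (shuffle_sign {a} (S - T) * ?g (insert a (S - T))))"
        by (simp only: swap[OF T(2)] mult_ac)
      finally show "?h T = shuffle_sign T (S - T) *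
          (psign q * ?f T * (shuffle_sign {a} (S - T) * ?g (insert a (S - T))))"
        by (simp only: sq[symmetric] mult_ac)
    qed (use False in auto)
    finally show ?thesis unfolding rhs by simp
  qed
qed

section \<open>Derivations\<close>

lemma derivation_addD: "derivation p X \<Longrightarrow> X (f + g) = X f + X g"
  by (simp add: derivation_def)

lemma derivation_const_multD: "derivation p X \<Longrightarrow> X (const c * f) = const c * X f"
  by (simp add: derivation_def)

lemma derivation_homogeneousD:
  "derivation p X \<Longrightarrow> homogeneous q f \<Longrightarrow> homogeneous (p + q) (X f)"
  by (simp add: derivation_def)

lemma derivation_multD:
  "derivation p X \<Longrightarrow> homogeneous q f \<Longrightarrow> X (f * g) = X f * g + psign (p * q) * f * X g"
  by (simp add: derivation_def)

lemma derivation_0D: "derivation p X \<Longrightarrow> X 0 = 0"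
  using derivation_addD[of p X 0 0] by simp

lemma derivation_diffD: "derivation p X \<Longrightarrow> X (f - g) = X f - X g"
  using derivation_addD[of p X "f - g" g] by simp

lemma derivation_sumD: "derivation p X \<Longrightarrow> X (\<Sum>i\<in>I. f i) = (\<Sum>i\<in>I. X (f i))"
  by (induction I rule: infinite_finite_induct) (simp_all add: derivation_0D derivation_addD)

lemma derivation_constD:
  assumes "derivation p X"
  shows "X (const c) = 0"
proof -
  have "X 1 = X 1 + X 1"
    using derivation_multD[OF assms homogeneous_1, of 1] by (simp add: psign_def)
  then have "X 1 = 0" by simp
  then show ?thesis using derivation_const_multD[OF assms, of c 1] by simp
qed

lemma derivation_zero: "derivation p (\<lambda>f. 0)"
  by (simp add: derivation_def homogeneous_0)

lemma derivation_add:
  assumes X: "derivation p X" and Y: "derivation p Y"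
  shows "derivation p (\<lambda>f. X f + Y f)"
  unfolding derivation_def
proof (intro conjI allI impI)
  fix f g c q
  show "X (f + g) + Y (f + g) = X f + Y f + (X g + Y g)"
    by (simp add: derivation_addD[OF X] derivation_addD[OF Y])
  show "X (const c * f) + Y (const c * f) = const c * (X f + Y f)"
    by (simp add: derivation_const_multD[OF X] derivation_const_multD[OF Y] distrib_left)
  assume f: "homogeneous q f"
  show "homogeneous (p + q) (X f + Y f)"
    by (intro homogeneous_add derivation_homogeneousD[OF X f] derivation_homogeneousD[OF Y f])
  show "X (f * g) + Y (f * g) = (X f + Y f) * g + psign (p * q) * f * (X g + Y g)"
    by (simp add: derivation_multD[OF X f] derivation_multD[OF Y f] algebra_simps)
qed

lemma derivation_sum:
  "(\<And>i. i \<in> I \<Longrightarrow> derivation p (X i)) \<Longrightarrow> derivation p (\<lambda>f. \<Sum>i\<in>I. X i f)"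
  by (induction I rule: infinite_finite_induct) (auto intro: derivation_zero derivation_add)

text \<open>Moving \<open>c\<close> past \<open>f\<close> costs \<open>psign (q * r)\<close>, which
  joins the sign \<open>psign (p * r)\<close> of \<open>X\<close> to give the sign for the total
  parity \<open>q + p\<close>.\<close>

lemma derivation_left_mult:
  assumes c: "homogeneous q c" and X: "derivation p X"
  shows "derivation (q + p) (\<lambda>f. c * X f)"
  unfolding derivation_def
proof (intro conjI allI impI)
  fix f g d r
  show "c * X (f + g) = c * X f + c * X g"
    by (simp add: derivation_addD[OF X] distrib_left)
  show "c * X (const d * f) = const d * (c * X f)"
    by (simp add: derivation_const_multD[OF X] const_commute[of d c] mult.assoc[symmetric])
  assume f: "homogeneous r f"
  show "homogeneous (q + p + r) (c * X f)"
    using homogeneous_mult[OF c derivation_homogeneousD[OF X f]] by (simp only: add.assoc)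
  have "c * (psign (p * r) * f * X g) = psign (p * r) * (c * f) * X g"
    using psign_commute[of "p * r" c] by (simp add: mult.assoc[symmetric])
  also have "\<dots> = psign (p * r) * (psign (q * r) * (f * c)) * X g"
    using supercommute[OF c f] by simp
  also have "\<dots> = psign ((q + p) * r) * f * (c * X g)"
    by (simp only: distrib_right add.commute[of q p] psign_add mult.assoc)
  finally show "c * X (f * g) = c * X f * g + psign ((q + p) * r) * f * (c * X g)"
    by (simp add: derivation_multD[OF X f] distrib_left mult.assoc)
qed

lemma const_uminus: "const (- c) = - const c"
  by (rule superfun_eqI) (simp add: const.rep_eq uminus_superfun.rep_eq)

lemma derivation_uminus: "derivation p X \<Longrightarrow> derivation p (\<lambda>f. - X f)"
  using derivation_left_mult[OF homogeneous_const, of p X "-1"]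
  unfolding add_0 const_uminus by simp

lemma derivation_diff:
  assumes "derivation p X" "derivation p Y"
  shows "derivation p (\<lambda>f. X f - Y f)"
  using derivation_add[OF assms(1) derivation_uminus[OF assms(2)]] by simp

section \<open>Partial derivatives as derivations\<close>

lemma partial_coord: "partial i (\<lambda>x. complex_of_real (x $ j)) = (\<lambda>_. if i = j then 1 else 0)"
proof
  fix x :: "real ^ 'a"
  have "((\<lambda>x. complex_of_real (x $ j)) has_derivative (\<lambda>h. complex_of_real (h $ j))) (at x)"
    by (intro bounded_linear_imp_has_derivative bounded_linear_compose[OF bounded_linear_of_real]
        bounded_linear_vec_nth)
  from partial_eq[OF this]
  show "partial i (\<lambda>x. complex_of_real (x $ j)) x = (if i = j then 1 else 0)"
    by (simp add: axis_def)
qed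

lemma pdiff_coord: "pdiff A (coord B) = (if A = B then 1 else 0)"
proof (rule superfun_eqI)
  fix x S
  show "Rep_superfun (pdiff A (coord B)) x S = Rep_superfun (if A = B then 1 else 0) x S"
  proof (cases A; cases B)
    fix i j assume AB: "A = Inl i" "B = Inl j"
    show ?thesis
      by (cases "S = {}") (auto simp: AB pdiff.rep_eq coord.rep_eq one_superfun.rep_eq
          zero_superfun.rep_eq gone_def partial_coord partial_const)
  next
    fix i b assume AB: "A = Inl i" "B = Inr b"
    show ?thesis
      by (cases "S = {b}") (simp_all add: AB pdiff.rep_eq coord.rep_eq zero_superfun.rep_eq partial_const)
  qed (auto simp: pdiff.rep_eq coord.rep_eq one_superfun.rep_eq zero_superfun.rep_eq gone_def)
qed

lemma pdiff_const: "pdiff A (const c) = 0"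
proof (rule superfun_eqI)
  fix x S
  show "Rep_superfun (pdiff A (const c)) x S = Rep_superfun 0 x S"
    by (cases A) (auto simp: pdiff.rep_eq const.rep_eq zero_superfun.rep_eq partial_const)
qed

lemma derivation_pdiff_even:
  fixes i :: "'e::finite"
  shows "derivation 0 (pdiff (Inl i) :: ('e, 'o::{finite,linorder}) operator)"
  unfolding derivation_def
proof (intro conjI allI impI)
  fix q and f :: "('e, 'o) superfun" assume f: "homogeneous q f"
  then have "(\<lambda>x. Rep_superfun f x S) = (\<lambda>_. 0)" if "of_nat (card S) \<noteq> q" for S
    using that by (auto simp: homogeneous_iff)
  then show "homogeneous (0 + q) (pdiff (Inl i) f)"
    by (auto simp: homogeneous_iff pdiff.rep_eq partial_const)
qed (simp_all add: pdiff_add pdiff_even_mult pdiff_const psign_def)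

lemma derivation_pdiff_odd:
  fixes a :: "'o::{finite,linorder}"
  shows "derivation 1 (pdiff (Inr a) :: ('e::finite, 'o) operator)"
  unfolding derivation_def
proof (intro conjI allI impI)
  fix q and f :: "('e, 'o) superfun" assume f: "homogeneous q f"
  have "Rep_superfun f x (insert a S) = 0" if "of_nat (card S) \<noteq> 1 + q" "a \<notin> S" for x S
  proof (rule homogeneousD[OF f])
    show "of_nat (card (insert a S)) \<noteq> q"
      using that by (cases q) (auto simp: of_nat_bit_eq split: if_splits)
  qed
  then show "homogeneous (1 + q) (pdiff (Inr a) f)"
    by (auto simp: homogeneous_iff Rep_superfun_pdiff_odd)
qed (simp_all add: pdiff_add pdiff_odd_mult pdiff_odd_mult[OF homogeneous_const] pdiff_const psign_def)

section \<open>Derivations are determined by the coordinates\<close>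

text \<open>The embedding of functions of the even coordinates alone. It goes through
  \<open>Abs_superfun\<close>, so its values are known only for smooth \<open>h\<close>.\<close>

definition body_fun :: "(real ^ 'e \<Rightarrow> complex) \<Rightarrow> ('e::finite, 'o::{finite,linorder}) superfun"
  where "body_fun h = Abs_superfun (\<lambda>x S. if S = {} then h x else 0)"

lemma Rep_body_fun:
  assumes "smooth h"
  shows "Rep_superfun (body_fun h) x S = (if S = {} then h x else 0)"
proof -
  have "smooth (\<lambda>x. if S = {} then h x else 0)" for S :: "'o::{finite,linorder} set"
    using assms by (cases "S = {}") (simp_all add: smooth_const)
  then show ?thesis
    unfolding body_fun_def by (subst Abs_superfun_inverse) auto
qed

lemma homogeneous_body_fun: "smooth h \<Longrightarrow> homogeneous 0 (body_fun h)"
  by (auto simp: homogeneous_iff Rep_body_fun)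

lemma Rep_body_fun_mult: "smooth h \<Longrightarrow> Rep_superfun (body_fun h * f) x S = h x * Rep_superfun f x S"
  by (simp add: times_superfun.rep_eq gmult_body_left Rep_body_fun)

lift_definition odd_monomial :: "'o set \<Rightarrow> ('e::finite, 'o::{finite,linorder}) superfun"
  is "\<lambda>T x S. if S = T then 1 else 0"
  by (rule smooth_const)

lemma odd_monomial_empty: "odd_monomial {} = 1"
  by (rule superfun_eqI) (simp add: odd_monomial.rep_eq one_superfun.rep_eq gone_def)

text \<open>With \<open>b\<close> below all of \<open>A\<close> the product is already in increasing
  order, so no sign appears. This suits an induction that adds the least generator last.\<close>

lemma odd_monomial_insert:
  assumes "\<forall>a\<in>A. b < a"
  shows "odd_monomial (insert b A) = coord (Inr b) * odd_monomial A"
proof (rule superfun_eqI)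
  fix x S
  have b: "b \<notin> A" using assms by auto
  have "{(c, a). c \<in> {b} \<and> a \<in> A \<and> a < c} = {}" using assms by auto
  then have s: "shuffle_sign {b} A = 1" unfolding shuffle_sign_def by (simp only: card.empty power_0)
  have "Rep_superfun (coord (Inr b) * odd_monomial A) x S =
      (\<Sum>T\<in>Pow S. if T = {b} then (if S = insert b A then 1 else 0) else 0)"
    unfolding times_superfun.rep_eq gmult_def
    by (rule sum.cong) (use b s in \<open>auto simp: coord.rep_eq odd_monomial.rep_eq\<close>)
  also have "\<dots> = (if S = insert b A then 1 else 0)" by auto
  finally show "Rep_superfun (odd_monomial (insert b A)) x S =
      Rep_superfun (coord (Inr b) * odd_monomial A) x S"
    by (simp add: odd_monomial.rep_eq)
qed

lemma superfun_expansion: "f = (\<Sum>T\<in>UNIV. body_fun (\<lambda>x. Rep_superfun f x T) * odd_monomial T)"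
  by (rule superfun_eqI)
    (simp add: Rep_superfun_sum Rep_body_fun_mult smooth_Rep_superfun odd_monomial.rep_eq
      if_distrib[of "\<lambda>c. _ * c"] cong: if_cong)

text \<open>
  Hadamard's lemma at \<open>p\<close> writes the function as a constant plus a combination of the functions
  \<open>x\<^sup>i - p\<^sup>i\<close>, which the derivation kills and which vanish at \<open>p\<close>.
\<close>

lemma derivation_body_fun_eq_0:
  assumes X: "derivation p X" and coord0: "\<And>i. X (coord (Inl i)) = 0" and h: "smooth h"
  shows "X (body_fun h) = 0"
proof (rule superfun_eqI)
  fix x S
  \<comment> \<open>The base point is the very point \<open>x\<close> at which the value is to be
    computed.\<close>
  obtain g where g: "\<And>i. smooth (g i)"
    and hg: "\<And>y. h y = h x + (\<Sum>i\<in>UNIV. of_real (y $ i - x $ i) * g i y)"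
    using hadamard[OF h, of x] by blast
  let ?m = "\<lambda>i. coord (Inl i) - const (complex_of_real (x $ i))"
  have m: "homogeneous 0 (?m i)" for i
    using homogeneous_add[OF homogeneous_even_coord homogeneous_uminus[OF homogeneous_const]] by simp
  have Rm: "Rep_superfun (?m i * f) y S = of_real (y $ i - x $ i) * Rep_superfun f y S" for i f y S
    by (simp add: left_diff_distrib Rep_superfun_minus Rep_superfun_even_coord_mult Rep_superfun_const_mult)
  have e1: "body_fun h = const (h x) + (\<Sum>i\<in>UNIV. ?m i * body_fun (g i))"
  proof (rule superfun_eqI)
    fix y S
    show "Rep_superfun (body_fun h) y S =
        Rep_superfun (const (h x) + (\<Sum>i\<in>UNIV. ?m i * body_fun (g i))) y S"
      using hg[of y]
      by (simp only: plus_superfun.rep_eq Rep_superfun_sum Rm Rep_body_fun[OF h] Rep_body_fun[OF g]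
          const.rep_eq) simp
  qed
  have e2: "X (?m i * f) = ?m i * X f" for i f
    using derivation_multD[OF X m, of i f]
    by (simp add: derivation_diffD[OF X] coord0 derivation_constD[OF X] psign_def)
  have "X (body_fun h) = (\<Sum>i\<in>UNIV. ?m i * X (body_fun (g i)))"
    unfolding e1 derivation_addD[OF X] derivation_sumD[OF X] derivation_constD[OF X] e2 by simp
  then show "Rep_superfun (X (body_fun h)) x S = Rep_superfun 0 x S"
    by (simp add: Rep_superfun_sum Rm zero_superfun.rep_eq)
qed

text \<open>The Leibniz rule reduces each term of \<open>superfun_expansion\<close> to its two
  factors: a function of the even coordinates, covered by \<open>derivation_body_fun_eq_0\<close>,
  and an odd monomial, covered by induction on its generators.\<close>

lemma derivation_eq_0:
  assumes X: "derivation p X" and coord0: "\<And>A. X (coord A) = 0"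
  shows "X f = 0"
proof -
  have mono: "X (odd_monomial T) = 0" if "finite T" for T
    using that
  proof (induction T rule: finite_linorder_min_induct)
    case empty
    then show ?case using derivation_constD[OF X, of 1] by (simp add: odd_monomial_empty)
  next
    case (insert b A)
    then show ?case
      by (simp add: odd_monomial_insert derivation_multD[OF X homogeneous_odd_coord] coord0)
  qed
  have "X (body_fun (\<lambda>x. Rep_superfun f x T) * odd_monomial T) = 0" for T
    by (simp add: derivation_multD[OF X homogeneous_body_fun[OF smooth_Rep_superfun]] mono
        derivation_body_fun_eq_0[OF X coord0 smooth_Rep_superfun])
  then show ?thesis
    by (subst superfun_expansion) (simp add: derivation_sumD[OF X])
qed

lemma derivation_eqI:
  assumes "derivation p X" "derivation p Y" "\<And>A. X (coord A) = Y (coord A)"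
  shows "X = Y"
  using derivation_eq_0[OF derivation_diff[OF assms(1,2)]] assms(3) by (simp add: fun_eq_iff)

text \<open>\<open>X0\<close> preserves and \<open>X1\<close> flips parity, so the projections in
  \<open>op_part\<close> select exactly one of them. Hence the parity components of a vector field
  do not depend on the chosen decomposition.\<close>

lemma op_part_eq:
  assumes X0: "derivation 0 X0" and X1: "derivation 1 X1"
  shows "op_part 0 (\<lambda>f. X0 f + X1 f) = X0" "op_part 1 (\<lambda>f. X0 f + X1 f) = X1"
proof -
  have h: "homogeneous q (X0 (part q f))" "homogeneous (1 + q) (X1 (part q f))" for q f
    using derivation_homogeneousD[OF X0 homogeneous_part, of q f]
      derivation_homogeneousD[OF X1 homogeneous_part, of q f] unfolding add_0 .
  have "op_part 0 (\<lambda>f. X0 f + X1 f) f = X0 (part 0 f + part 1 f)" for f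
    using h[of 0 f] h[of 1 f]
    by (simp add: op_part_def part_add part_homogeneous derivation_addD[OF X0])
  then show "op_part 0 (\<lambda>f. X0 f + X1 f) = X0" by (simp add: sum_parts fun_eq_iff)
  have "op_part 1 (\<lambda>f. X0 f + X1 f) f = X1 (part 0 f + part 1 f)" for f
    using h[of 0 f] h[of 1 f]
    by (simp add: op_part_def part_add part_homogeneous derivation_addD[OF X1])
  then show "op_part 1 (\<lambda>f. X0 f + X1 f) = X1" by (simp add: sum_parts fun_eq_iff)
qed

text \<open>Project \<open>f = g\<close> to parity \<open>p\<close>: the left side stays, the right
  side becomes 0. This keeps the even and odd parts of a vector field from compensating each
  other.\<close>

lemma homogeneous_diff_eq_0:
  assumes "homogeneous p f" "homogeneous q g" "p \<noteq> q" "f - g = 0"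
  shows "f = 0" "g = 0"
proof -
  have "part p f = part p g" using assms(4) by simp
  with assms(1-3) show "f = 0" by (simp add: part_homogeneous)
  with assms(4) show "g = 0" by simp
qed

section \<open>Functions as forms and left spans\<close>

text \<open>\<open>Inl\<close> preserves the order of the generators; this is why
  \<open>pull\<close> is compatible with the signs of products.\<close>

lemma shuffle_sign_Inl_image:
  fixes A B :: "'a::linorder set"
  shows "shuffle_sign (Inl ` A :: ('a + 'b::linorder) set) (Inl ` B) = shuffle_sign A B"
proof -
  have "{(a, b). a \<in> Inl ` A \<and> b \<in> Inl ` B \<and> b < a} =
      map_prod Inl (Inl :: 'a \<Rightarrow> 'a + 'b) ` {(a, b). a \<in> A \<and> b \<in> B \<and> b < a}"
    by (auto simp: less_sum_def less_eq_sum_def)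
  then have "card {(a, b). a \<in> Inl ` A \<and> b \<in> (Inl ` B :: ('a + 'b) set) \<and> b < a} =
      card {(a, b). a \<in> A \<and> b \<in> B \<and> b < a}"
    by (simp add: card_image inj_on_def)
  then show ?thesis unfolding shuffle_sign_def by (simp only:)
qed

section \<open>Functions on the base as forms of degree zero\<close>

lemma pull_add: "pull (f + g) = pull f + pull g"
  by (rule superfun_eqI) (simp add: pull.rep_eq plus_superfun.rep_eq)

lemma pull_uminus: "pull (- f) = - pull f"
  by (rule superfun_eqI) (simp add: pull.rep_eq uminus_superfun.rep_eq)

lemma pull_diff: "pull (f - g) = pull f - pull g"
  using pull_add[of f "- g"] by (simp add: pull_uminus)

lemma pull_0 [simp]: "pull 0 = 0"
  by (rule superfun_eqI) (simp add: pull.rep_eq zero_superfun.rep_eq)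

lemma pull_sum: "pull (\<Sum>i\<in>I. f i) = (\<Sum>i\<in>I. pull (f i))"
  by (induction I rule: infinite_finite_induct) (simp_all add: pull_add)

lemma pull_const: "pull (const c) = const c"
proof (rule superfun_eqI)
  fix z :: "real ^ ('a + 'b)" and S :: "('b + 'a) set"
  have "Inl -` S = {} \<longleftrightarrow> S = {}" if "S \<subseteq> range Inl" using that by auto
  then show "Rep_superfun (pull (const c)) z S = Rep_superfun (const c) z S"
    by (auto simp: pull.rep_eq const.rep_eq)
qed

lemma pull_coord: "pull (coord B) = coord (base_ix B)"
proof (rule superfun_eqI)
  fix z :: "real ^ ('a + 'b)" and S :: "('b + 'a) set"
  have "Inl -` S = {} \<longleftrightarrow> S = {}" "Inl -` S = {b} \<longleftrightarrow> S = {Inl b}" if "S \<subseteq> range Inl" for b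
    using that by auto
  then show "Rep_superfun (pull (coord B)) z S = Rep_superfun (coord (base_ix B)) z S"
    by (auto simp: pull.rep_eq coord.rep_eq base_ix_def proj_Inl_def split: sum.splits)
qed

text \<open>If \<open>S\<close> consists of odd base coordinates, its subsets correspond to those of
  its preimage with equal signs. If it contains an odd differential, one of \<open>T\<close> and
  \<open>S - T\<close> contains it too, and that factor vanishes.\<close>

lemma pull_mult: "pull (f * g) = pull f * pull g"
proof (rule superfun_eqI)
  fix z :: "real ^ ('a + 'b)" and S :: "('b + 'a) set"
  let ?f = "Rep_superfun f (proj_Inl z)" and ?g = "Rep_superfun g (proj_Inl z)"
  let ?F = "Rep_superfun (pull f) z" and ?G = "Rep_superfun (pull g) z"
  show "Rep_superfun (pull (f * g)) z S = Rep_superfun (pull f * pull g) z S"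
  proof (cases "S \<subseteq> range Inl")
    case True
    then obtain R where R: "S = Inl ` R" by (auto simp: subset_image_iff)
    have F: "?F (Inl ` T) = ?f T" "?G (Inl ` T) = ?g T" for T
      by (auto simp: pull.rep_eq inj_vimage_image_eq)
    have d: "Inl ` R - Inl ` T = Inl ` (R - T)" for T
      by (simp add: image_set_diff)
    have "Rep_superfun (pull f * pull g) z S =
        (\<Sum>T\<in>(`) Inl ` Pow R. shuffle_sign T (S - T) * (?F T * ?G (S - T)))"
      by (simp add: times_superfun.rep_eq gmult_def R image_Pow_surj)
    also have "\<dots> = (\<Sum>T\<in>Pow R. shuffle_sign T (R - T) * (?f T * ?g (R - T)))"
      by (intro sum.reindex_cong[where l = "(`) Inl"])
        (auto simp: R d F shuffle_sign_Inl_image inj_on_def inj_image_eq_iff)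
    also have "\<dots> = Rep_superfun (pull (f * g)) z S"
      using True by (simp add: pull.rep_eq R times_superfun.rep_eq gmult_def inj_vimage_image_eq)
    finally show ?thesis by simp
  next
    case False
    have "Rep_superfun (pull f * pull g) z S = 0"
      unfolding times_superfun.rep_eq gmult_def
    proof (rule sum.neutral, rule ballI)
      fix T assume "T \<in> Pow S"
      with False have "\<not> T \<subseteq> range Inl \<or> \<not> S - T \<subseteq> range Inl" by auto
      then show "shuffle_sign T (S - T) * (?F T * ?G (S - T)) = 0"
        by (auto simp: pull.rep_eq)
    qed
    with False show ?thesis by (simp add: pull.rep_eq)
  qed
qed

lemma pull_eq_0D:
  fixes f :: "('e::{finite,linorder}, 'o::{finite,linorder}) superfun"
  assumes "pull f = 0"
  shows "f = 0"
proof (rule superfun_eqI)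
  fix x :: "(real, 'e) vec" and S :: "'o set"
  \<comment> \<open>The point over \<open>x\<close> at which all even differentials are
    zero.\<close>
  let ?z = "(\<chi> A. case A of Inl i \<Rightarrow> x $ i | Inr _ \<Rightarrow> 0) :: real ^ ('e + 'o)"
  have "proj_Inl ?z = x" by (simp add: proj_Inl_def vec_eq_iff)
  then have "Rep_superfun f x S = Rep_superfun (pull f) ?z (Inl ` S)"
    by (auto simp: pull.rep_eq inj_vimage_image_eq)
  then show "Rep_superfun f x S = Rep_superfun 0 x S"
    using assms by (simp add: zero_superfun.rep_eq)
qed

text \<open>A pulled-back function is constant along the line through \<open>z\<close> in the
  direction of the differential, so its directional derivative there is 0 by uniqueness of
  derivatives.\<close>

lemma pdiff_odd_differential_pull: "pdiff (diff_ix (Inr a)) (pull f) = 0"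
proof (rule superfun_eqI)
  fix z :: "real ^ ('a + 'b)" and S :: "('b + 'a) set"
  let ?h = "\<lambda>z. Rep_superfun (pull f) z S"
  have "(?h has_derivative frechet_derivative ?h (at z)) (at (z + 0 *\<^sub>R axis (Inr a) 1))"
    using smooth_differentiable[OF smooth_Rep_superfun] by (simp add: frechet_derivative_works)
  moreover have "((\<lambda>t. z + t *\<^sub>R axis (Inr a) 1) has_derivative (\<lambda>t. t *\<^sub>R axis (Inr a) 1)) (at 0)"
    by (auto intro!: derivative_eq_intros)
  ultimately have "((\<lambda>t. ?h (z + t *\<^sub>R axis (Inr a) 1)) has_derivative
      (\<lambda>t. frechet_derivative ?h (at z) (t *\<^sub>R axis (Inr a) 1))) (at 0)"
    using diff_chain_at[of "\<lambda>t. z + t *\<^sub>R axis (Inr a) 1" _ "0 :: real" ?h] by (simp add: o_def)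
  moreover have "(\<lambda>t. ?h (z + t *\<^sub>R axis (Inr a) 1)) = (\<lambda>_. ?h z)"
  proof
    fix t
    have "proj_Inl (z + t *\<^sub>R axis (Inr a) 1) = proj_Inl z"
      by (simp add: proj_Inl_def axis_def vec_eq_iff)
    then show "?h (z + t *\<^sub>R axis (Inr a) 1) = ?h z" by (simp add: pull.rep_eq)
  qed
  ultimately have "((\<lambda>_. ?h z) has_derivative
      (\<lambda>t. frechet_derivative ?h (at z) (t *\<^sub>R axis (Inr a) 1))) (at (0 :: real))"
    by simp
  from has_derivative_unique[OF this has_derivative_const]
  have "frechet_derivative ?h (at z) (1 *\<^sub>R axis (Inr a) 1) = 0"
    by metis
  then show "Rep_superfun (pdiff (diff_ix (Inr a)) (pull f)) z S = Rep_superfun 0 z S"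
    by (simp add: pdiff.rep_eq diff_ix_def partial_def zero_superfun.rep_eq)
qed

text \<open>The sign in the interior derivative is 1 on the even part and -1 on the odd part, so
  both merge into the coefficients of \<open>X0 - X1\<close>.\<close>

lemma int_deriv_eq:
  assumes "derivation 0 X0" "derivation 1 X1"
  shows "int_deriv (\<lambda>f. X0 f + X1 f) \<Omega> A =
    (\<Sum>B\<in>UNIV. pull (X0 (coord B) - X1 (coord B)) * pdiff (diff_ix B) (\<Omega> A))"
  by (simp add: int_deriv_def int_deriv_hom_def op_part_eq[OF assms] psign_def pull_diff
      left_diff_distrib sum_subtractf sum_negf)

lemma sum_UNIV_Plus:
  fixes f :: "'a::finite + 'b::finite \<Rightarrow> 'c::comm_monoid_add"
  shows "(\<Sum>A\<in>UNIV. f A) = (\<Sum>i\<in>UNIV. f (Inl i)) + (\<Sum>j\<in>UNIV. f (Inr j))"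
  using sum.Plus[of UNIV UNIV f] by (simp add: UNIV_Plus_UNIV)

section \<open>Closure of left spans\<close>

lemma left_span_base:
  assumes "X \<in> B"
  shows "(\<lambda>g. c * X g) \<in> left_span B"
  unfolding left_span_def using assms
  by (intro CollectI exI[of _ "\<lambda>_. c"] exI[of _ "{X}"]) auto

lemma left_span_add:
  assumes "X \<in> left_span B" "Y \<in> left_span B"
  shows "(\<lambda>g. X g + Y g) \<in> left_span B"
proof -
  obtain c F where X: "X = (\<lambda>g. \<Sum>Z\<in>F. c Z * Z g)" "finite F" "F \<subseteq> B"
    using assms(1) unfolding left_span_def by blast
  obtain d G where Y: "Y = (\<lambda>g. \<Sum>Z\<in>G. d Z * Z g)" "finite G" "G \<subseteq> B"
    using assms(2) unfolding left_span_def by blast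
  \<comment> \<open>Extending both coefficient families by 0 lets the sums run over
    \<open>F \<union> G\<close>; generators in the overlap receive both coefficients.\<close>
  let ?e = "\<lambda>Z. (if Z \<in> F then c Z else 0) + (if Z \<in> G then d Z else 0)"
  have "(\<Sum>Z\<in>F. c Z * Z g) = (\<Sum>Z\<in>F \<union> G. (if Z \<in> F then c Z else 0) * Z g)"
    "(\<Sum>Z\<in>G. d Z * Z g) = (\<Sum>Z\<in>F \<union> G. (if Z \<in> G then d Z else 0) * Z g)" for g
    using X(2) Y(2) by (auto intro!: sum.mono_neutral_cong_left)
  then have "(\<lambda>g. X g + Y g) = (\<lambda>g. \<Sum>Z\<in>F \<union> G. ?e Z * Z g)"
    by (simp add: X(1) Y(1) distrib_right sum.distrib)
  then show ?thesis
    unfolding left_span_def using X(2,3) Y(2,3)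
    by (intro CollectI exI[of _ ?e] exI[of _ "F \<union> G"]) auto
qed

lemma left_span_sum:
  "(\<And>i. i \<in> I \<Longrightarrow> X i \<in> left_span B) \<Longrightarrow> (\<lambda>g. \<Sum>i\<in>I. X i g) \<in> left_span B"
proof (induction I rule: infinite_finite_induct)
  have "(\<lambda>g. 0) \<in> left_span B"
    unfolding left_span_def by (intro CollectI exI[of _ "\<lambda>_. 0"] exI[of _ "{}"]) auto
  then show "(\<lambda>g. \<Sum>i\<in>{}. X i g) \<in> left_span B"
    "infinite I \<Longrightarrow> (\<lambda>g. \<Sum>i\<in>I. X i g) \<in> left_span B" for I by simp_all
qed (auto intro: left_span_add)

section \<open>The SUSY contact structure\<close>

text \<open>The function \<open>V\<close> of the overview: the coefficient of
  \<open>d\<theta>\<close> in \<alpha> and, up to sign, of the even derivatives in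
  \<open>susy_D\<close>.\<close>

definition theta_coeff :: "4 \<Rightarrow> 2 \<Rightarrow> (4, 2 + 2) superfun"
  where "theta_coeff \<mu> a = const \<i> * (\<Sum>b\<in>UNIV. const (sigma \<mu> $ a $ b) * coord (thbar_ix b))"

text \<open>The function \<open>U\<close> of the overview, playing the same double role for
  \<open>susy_Dbar\<close>.\<close>

definition thetabar_coeff :: "4 \<Rightarrow> 2 \<Rightarrow> (4, 2 + 2) superfun"
  where "thetabar_coeff \<mu> b = const \<i> * (\<Sum>a\<in>UNIV. const (sigma \<mu> $ a $ b) * coord (th_ix a))"

lemma homogeneous_coeff:
  "homogeneous 1 (theta_coeff \<mu> a)" "homogeneous 1 (thetabar_coeff \<mu> a)"
proof -
  have h: "homogeneous 1 (const c * f)" if "homogeneous 1 f" for c and f :: "(4, 2 + 2) superfun"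
    using homogeneous_mult[OF homogeneous_const that, of c] unfolding add_0 .
  show "homogeneous 1 (theta_coeff \<mu> a)" "homogeneous 1 (thetabar_coeff \<mu> a)"
    unfolding theta_coeff_def thetabar_coeff_def
    by (intro h homogeneous_sum homogeneous_odd_coord)+
qed

lemma susy_D_eq:
  "susy_D a = (\<lambda>f. pdiff (th_ix a) f - (\<Sum>\<mu>\<in>UNIV. theta_coeff \<mu> a * pdiff (x_ix \<mu>) f))"
  by (simp add: susy_D_def theta_coeff_def fun_eq_iff sum_distrib_left sum_distrib_right mult.assoc)

lemma susy_Dbar_eq:
  "susy_Dbar a = (\<lambda>f. pdiff (thbar_ix a) f - (\<Sum>\<mu>\<in>UNIV. thetabar_coeff \<mu> a * pdiff (x_ix \<mu>) f))"
proof -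
  have "thetabar_coeff \<mu> a = const \<i> * (\<Sum>b\<in>UNIV. coord (th_ix b) * const (sigma \<mu> $ b $ a))" for \<mu>
    by (simp only: thetabar_coeff_def const_commute[where f = "coord B" for B])
  then show ?thesis
    by (simp add: susy_Dbar_def fun_eq_iff sum_distrib_left sum_distrib_right mult.assoc)
qed

lemma derivation_susy: "derivation 1 (susy_D a)" "derivation 1 (susy_Dbar a)"
proof -
  have "derivation 1 (\<lambda>f. c * pdiff (x_ix \<mu>) f)" if "homogeneous 1 c" for c \<mu>
    using derivation_left_mult[OF that derivation_pdiff_even] unfolding add_0_right .
  then show "derivation 1 (susy_D a)" "derivation 1 (susy_Dbar a)"
    unfolding susy_D_eq susy_Dbar_eq
    by (auto intro!: derivation_diff derivation_pdiff_odd derivation_sum homogeneous_coeff)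
qed

lemma susy_D_coord:
  "susy_D a (coord (x_ix \<mu>)) = - theta_coeff \<mu> a"
  "susy_D a (coord (th_ix b)) = (if a = b then 1 else 0)"
  "susy_D a (coord (thbar_ix b)) = 0"
  by (simp_all add: susy_D_eq pdiff_coord if_distrib[of "\<lambda>c. _ * c"] cong: if_cong)

lemma susy_Dbar_coord:
  "susy_Dbar a (coord (x_ix \<mu>)) = - thetabar_coeff \<mu> a"
  "susy_Dbar a (coord (th_ix b)) = 0"
  "susy_Dbar a (coord (thbar_ix b)) = (if a = b then 1 else 0)"
  by (simp_all add: susy_Dbar_eq pdiff_coord if_distrib[of "\<lambda>c. _ * c"] cong: if_cong)

text \<open>The component along \<open>\<partial>/\<partial>x\<^sup>\<mu>\<close> of \<open>i\<^sub>X \<alpha>\<close>, without the sign depending on the parity of \<open>X\<close>.\<close>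

definition alpha_contraction :: "(4, 2 + 2) operator \<Rightarrow> 4 \<Rightarrow> (4, 2 + 2) superfun"
  where "alpha_contraction X \<mu> = X (coord (x_ix \<mu>))
    + (\<Sum>a\<in>UNIV. X (coord (th_ix a)) * theta_coeff \<mu> a)
    + (\<Sum>a\<in>UNIV. X (coord (thbar_ix a)) * thetabar_coeff \<mu> a)"

text \<open>\<open>X\<close> takes an odd coordinate to parity \<open>p + 1\<close>, and the odd
  coefficient restores \<open>p\<close>.\<close>

lemma homogeneous_alpha_contraction:
  assumes X: "derivation p X"
  shows "homogeneous p (alpha_contraction X \<mu>)"
proof -
  have p: "p + 1 + 1 = p" by (cases p) simp_all
  have "homogeneous p (X (coord (Inr j)) * c)" if "homogeneous 1 c" for j c
    using homogeneous_mult[OF derivation_homogeneousD[OF X homogeneous_odd_coord[of j]] that]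
    by (simp only: p)
  moreover have "homogeneous p (X (coord (x_ix \<mu>)))"
    using derivation_homogeneousD[OF X homogeneous_even_coord] unfolding add_0_right .
  ultimately show ?thesis
    unfolding alpha_contraction_def by (auto intro!: homogeneous_add homogeneous_sum homogeneous_coeff)
qed

text \<open>The values of \<open>X\<close> stand on the left in every term, so left coefficients
  factor out without signs.\<close>

lemma alpha_contraction_left_combination:
  "alpha_contraction (\<lambda>f. \<Sum>i\<in>I. c i * X i f) \<mu> = (\<Sum>i\<in>I. c i * alpha_contraction (X i) \<mu>)"
proof -
  have "(\<Sum>a\<in>UNIV. (\<Sum>i\<in>I. c i * X i (y a)) * z a) = (\<Sum>i\<in>I. c i * (\<Sum>a\<in>UNIV. X i (y a) * z a))"
    for y z :: "2 \<Rightarrow> (4, 2 + 2) superfun"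
    by (simp add: sum_distrib_left sum_distrib_right mult.assoc) (rule sum.swap)
  then show ?thesis
    by (simp add: alpha_contraction_def distrib_left sum.distrib)
qed

text \<open>The component along \<open>x\<^sup>\<mu>\<close> is minus the coefficient that the
  single value 1 on the odd coordinates picks out.\<close>

lemma alpha_contraction_susy:
  "alpha_contraction (susy_D a) \<mu> = 0" "alpha_contraction (susy_Dbar a) \<mu> = 0"
  by (simp_all add: alpha_contraction_def susy_D_coord susy_Dbar_coord
      if_distrib[of "\<lambda>c. c * _"] cong: if_cong)

lemma pdiff_0 [simp]: "pdiff A 0 = 0"
  using pdiff_const[of A 0] by simp

lemma pdiff_sum: "pdiff A (\<Sum>i\<in>I. f i) = (\<Sum>i\<in>I. pdiff A (f i))"
  by (cases A) (simp_all add: derivation_sumD[OF derivation_pdiff_even] derivation_sumD[OF derivation_pdiff_odd])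

lemma pdiff_const_mult: "pdiff A (const c * f) = const c * pdiff A f"
  by (cases A)
    (simp_all add: derivation_const_multD[OF derivation_pdiff_even] derivation_const_multD[OF derivation_pdiff_odd])

section \<open>The contraction of \<alpha> and its kernel\<close>

lemma alpha_Inl:
  "alpha (Inl \<mu>) = coord (diff_ix (x_ix \<mu>)) + const \<i> * (\<Sum>a\<in>UNIV. \<Sum>b\<in>UNIV.
      const (sigma \<mu> $ a $ b) * (coord (base_ix (th_ix a)) * coord (diff_ix (thbar_ix b)))
    + const (sigma \<mu> $ a $ b) * (coord (diff_ix (th_ix a)) * coord (base_ix (thbar_ix b))))"
  by (simp add: alpha_def const_commute[where f = "coord B" for B, symmetric] mult.assoc)

lemmas ix_defs = base_ix_def diff_ix_def

lemma pdiff_alpha: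
  "pdiff (diff_ix (x_ix \<nu>)) (alpha (Inl \<mu>)) = (if \<nu> = \<mu> then 1 else 0)"
  "pdiff (diff_ix (th_ix a)) (alpha (Inl \<mu>)) = pull (theta_coeff \<mu> a)"
  "pdiff (diff_ix (thbar_ix b)) (alpha (Inl \<mu>)) = pull (thetabar_coeff \<mu> b)"
proof -
  show "pdiff (diff_ix (x_ix \<nu>)) (alpha (Inl \<mu>)) = (if \<nu> = \<mu> then 1 else 0)"
    by (simp add: alpha_Inl ix_defs pdiff_add pdiff_sum pdiff_const_mult pdiff_coord
        pdiff_odd_mult[OF homogeneous_odd_coord] pdiff_odd_mult[OF homogeneous_even_coord])
  show "pdiff (diff_ix (th_ix a)) (alpha (Inl \<mu>)) = pull (theta_coeff \<mu> a)"
    \<comment> \<open>The swap puts the sum over the row index of \<open>sigma\<close> inside, where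
      the derivative collapses it and leaves the sum over columns in
      \<open>theta_coeff\<close>.\<close>
    by (subst alpha_Inl, subst sum.swap) (simp add: theta_coeff_def pull_mult pull_sum pull_const pull_coord ix_defs pdiff_add
        pdiff_sum pdiff_const_mult pdiff_coord pdiff_even_mult if_distrib[of "\<lambda>c. c * _"]
        if_distrib[of "\<lambda>c. _ * c"] cong: if_cong)
  show "pdiff (diff_ix (thbar_ix b)) (alpha (Inl \<mu>)) = pull (thetabar_coeff \<mu> b)"
    by (simp add: alpha_Inl thetabar_coeff_def pull_mult pull_sum pull_const pull_coord ix_defs pdiff_add
        pdiff_sum pdiff_const_mult pdiff_coord pdiff_even_mult if_distrib[of "\<lambda>c. c * _"]
        if_distrib[of "\<lambda>c. _ * c"] cong: if_cong)
qed

text \<open>The components of the contraction are pullbacks of differences of an even and an odd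
  function. As \<open>pull\<close> is injective, both functions vanish separately.\<close>

lemma int_deriv_alpha_eq_0_iff:
  assumes X0: "derivation 0 X0" and X1: "derivation 1 X1"
  shows "int_deriv (\<lambda>f. X0 f + X1 f) alpha = (\<lambda>A. 0) \<longleftrightarrow>
    (\<forall>\<mu>. alpha_contraction X0 \<mu> = 0 \<and> alpha_contraction X1 \<mu> = 0)"
proof -
  let ?Y = "\<lambda>B. X0 (coord B) - X1 (coord B)"
  have x: "int_deriv (\<lambda>f. X0 f + X1 f) alpha (Inl \<mu>) =
      pull (alpha_contraction X0 \<mu> - alpha_contraction X1 \<mu>)" for \<mu>
  proof -
    have "int_deriv (\<lambda>f. X0 f + X1 f) alpha (Inl \<mu>) = pull (?Y (x_ix \<mu>))
        + ((\<Sum>a\<in>UNIV. pull (?Y (th_ix a)) * pull (theta_coeff \<mu> a))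
        + (\<Sum>a\<in>UNIV. pull (?Y (thbar_ix a)) * pull (thetabar_coeff \<mu> a)))"
      by (simp add: int_deriv_eq[OF X0 X1] sum_UNIV_Plus pdiff_alpha
          if_distrib[of "\<lambda>c. _ * c"] cong: if_cong)
    also have "\<dots> = pull (alpha_contraction X0 \<mu> - alpha_contraction X1 \<mu>)"
      unfolding alpha_contraction_def pull_mult[symmetric] pull_sum[symmetric] pull_add[symmetric]
      by (simp add: left_diff_distrib sum_subtractf algebra_simps)
    finally show ?thesis .
  qed
  have "int_deriv (\<lambda>f. X0 f + X1 f) alpha (Inr j) = 0" for j
  proof -
    have "alpha (Inr j) = 0" by (simp add: alpha_def)
    then show ?thesis by (simp add: int_deriv_eq[OF X0 X1])
  qed
  then have "int_deriv (\<lambda>f. X0 f + X1 f) alpha = (\<lambda>A. 0) \<longleftrightarrow>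
      (\<forall>\<mu>. pull (alpha_contraction X0 \<mu> - alpha_contraction X1 \<mu>) = 0)"
    by (simp add: fun_eq_iff split_sum_all x)
  also have "\<dots> \<longleftrightarrow> (\<forall>\<mu>. alpha_contraction X0 \<mu> = 0 \<and> alpha_contraction X1 \<mu> = 0)"
  proof (intro iff_allI iffI)
    fix \<mu>
    assume "pull (alpha_contraction X0 \<mu> - alpha_contraction X1 \<mu>) = 0"
    then have "alpha_contraction X0 \<mu> - alpha_contraction X1 \<mu> = 0" by (rule pull_eq_0D)
    from homogeneous_diff_eq_0[OF homogeneous_alpha_contraction[OF X0]
        homogeneous_alpha_contraction[OF X1] zero_neq_one this]
    show "alpha_contraction X0 \<mu> = 0 \<and> alpha_contraction X1 \<mu> = 0" ..
  qed simp
  finally show ?thesis .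
qed

lemma form_kernel_alpha_iff:
  "X \<in> form_kernel alpha \<longleftrightarrow> (\<exists>X0 X1. derivation 0 X0 \<and> derivation 1 X1 \<and> X = (\<lambda>f. X0 f + X1 f) \<and>
    (\<forall>\<mu>. alpha_contraction X0 \<mu> = 0 \<and> alpha_contraction X1 \<mu> = 0))"
  unfolding form_kernel_def Vect_def using int_deriv_alpha_eq_0_iff by blast

text \<open>Both sides are derivations of parity \<open>p\<close>, so comparing them on coordinates
  suffices. On the odd coordinates they agree by duality with the SUSY fields; on
  \<open>x\<^sup>\<mu>\<close> the equality is the vanishing of the contraction.\<close>

lemma derivation_susy_expansion:
  assumes X: "derivation p X" and K: "\<And>\<mu>. alpha_contraction X \<mu> = 0"
  shows "X = (\<lambda>f. (\<Sum>a\<in>UNIV. X (coord (th_ix a)) * susy_D a f)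
    + (\<Sum>a\<in>UNIV. X (coord (thbar_ix a)) * susy_Dbar a f))"
proof (rule derivation_eqI[OF X])
  have p: "p + 1 + 1 = p" by (cases p) simp_all
  have "derivation p (\<lambda>f. X (coord (Inr j)) * D f)" if "derivation 1 D" for j D
    using derivation_left_mult[OF derivation_homogeneousD[OF X homogeneous_odd_coord[of j]] that]
    by (simp only: p)
  then show "derivation p (\<lambda>f. (\<Sum>a\<in>UNIV. X (coord (th_ix a)) * susy_D a f)
      + (\<Sum>a\<in>UNIV. X (coord (thbar_ix a)) * susy_Dbar a f))"
    by (auto intro!: derivation_add derivation_sum derivation_susy)
  fix A :: "4 + (2 + 2)"
  consider \<mu> where "A = x_ix \<mu>" | a where "A = th_ix a" | a where "A = thbar_ix a"
    by (cases A; cases "projr A") auto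
  then show "X (coord A) = (\<Sum>a\<in>UNIV. X (coord (th_ix a)) * susy_D a (coord A))
      + (\<Sum>a\<in>UNIV. X (coord (thbar_ix a)) * susy_Dbar a (coord A))"
  proof cases
    case 1
    then show ?thesis
      using K[of \<mu>]
      by (simp add: susy_D_coord susy_Dbar_coord alpha_contraction_def sum_negf eq_diff_eq
          eq_neg_iff_add_eq_0 ac_simps)
  qed (simp_all add: susy_D_coord susy_Dbar_coord if_distrib[of "\<lambda>c. _ * c"] cong: if_cong)
qed

lemma form_kernel_alpha_eq: "form_kernel alpha = left_span (range susy_D \<union> range susy_Dbar)"
proof (intro equalityI subsetI)
  fix X assume "X \<in> form_kernel alpha"
  then obtain X0 X1 where X: "derivation 0 X0" "derivation 1 X1" "X = (\<lambda>f. X0 f + X1 f)"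
    and K: "\<And>\<mu>. alpha_contraction X0 \<mu> = 0" "\<And>\<mu>. alpha_contraction X1 \<mu> = 0"
    unfolding form_kernel_alpha_iff by blast
  let ?B = "range susy_D \<union> range susy_Dbar"
  have "(\<lambda>f. (\<Sum>a\<in>UNIV. c a * susy_D a f) + (\<Sum>a\<in>UNIV. d a * susy_Dbar a f)) \<in> left_span ?B" for c d
    by (intro left_span_add left_span_sum left_span_base) auto
  then have "X0 \<in> left_span ?B" "X1 \<in> left_span ?B"
    by (subst derivation_susy_expansion[OF X(1) K(1)] derivation_susy_expansion[OF X(2) K(2)], assumption)+
  then show "X \<in> left_span ?B" unfolding X(3) by (rule left_span_add)
next
  fix X assume "X \<in> left_span (range susy_D \<union> range susy_Dbar)"
  then obtain c F where X: "X = (\<lambda>g. \<Sum>Y\<in>F. c Y * Y g)"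
    and F: "F \<subseteq> range susy_D \<union> range susy_Dbar"
    unfolding left_span_def by blast
  have D: "derivation 1 Y" "alpha_contraction Y \<mu> = 0" if "Y \<in> F" for Y \<mu>
    using F that derivation_susy alpha_contraction_susy by blast+
  have der: "derivation (q + 1) (\<lambda>g. \<Sum>Y\<in>F. part q (c Y) * Y g)" for q
    by (intro derivation_sum derivation_left_mult homogeneous_part D)
  have K: "alpha_contraction (\<lambda>g. \<Sum>Y\<in>F. part q (c Y) * Y g) \<mu> = 0" for q \<mu>
    by (simp add: alpha_contraction_left_combination D)
  \<comment> \<open>The SUSY fields are odd, so odd coefficients yield the even part of
    \<open>X\<close> and even coefficients the odd part.\<close>
  have "X = (\<lambda>g. (\<Sum>Y\<in>F. part 1 (c Y) * Y g) + (\<Sum>Y\<in>F. part 0 (c Y) * Y g))"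
    unfolding X sum.distrib[symmetric] distrib_right[symmetric] add.commute[of "part 1 _"] sum_parts ..
  moreover have "derivation 0 (\<lambda>g. \<Sum>Y\<in>F. part 1 (c Y) * Y g)"
    "derivation 1 (\<lambda>g. \<Sum>Y\<in>F. part 0 (c Y) * Y g)"
    using der[of 1] der[of 0] by simp_all
  ultimately show "X \<in> form_kernel alpha"
    unfolding form_kernel_alpha_iff using K by blast
qed

section \<open>Non-degeneracy of the exterior derivative\<close>

text \<open>The factor 2 arises because differentiating in \<theta> and in its conjugate produces
  the same product of differentials, which are even and commute.\<close>

lemma ext_deriv_alpha_time: "ext_deriv alpha (Inl 0) =
  const (2 * \<i>) * (\<Sum>a\<in>UNIV. coord (diff_ix (th_ix a)) * coord (diff_ix (thbar_ix a)))"
proof -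
  let ?d = "\<lambda>A. coord (diff_ix A) :: (4, 2 + 2) form"
  have s: "const (sigma 0 $ a $ b) * f = (if a = b then f else 0)" for a b and f :: "(4, 2 + 2) form"
    by (simp add: sigma_def mat_def)
  have x: "pdiff (base_ix (x_ix \<mu>)) (alpha (Inl 0)) = 0" for \<mu>
    by (simp add: alpha_Inl s ix_defs pdiff_add pdiff_sum pdiff_const_mult pdiff_coord pdiff_even_mult
        if_distrib[of "pdiff _"] cong: if_cong)
  have th: "pdiff (base_ix (th_ix a)) (alpha (Inl 0)) = const \<i> * ?d (thbar_ix a)" for a
    by (simp add: alpha_Inl s sum.distrib ix_defs pdiff_add pdiff_sum pdiff_const_mult pdiff_coord
        pdiff_odd_mult[OF homogeneous_odd_coord] pdiff_odd_mult[OF homogeneous_even_coord]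
        if_distrib[of "\<lambda>c. c * _"] cong: if_cong)
  have thbar: "pdiff (base_ix (thbar_ix a)) (alpha (Inl 0)) = const \<i> * ?d (th_ix a)" for a
    by (simp add: alpha_Inl s sum.distrib ix_defs pdiff_add pdiff_sum pdiff_const_mult pdiff_coord
        pdiff_odd_mult[OF homogeneous_odd_coord] pdiff_odd_mult[OF homogeneous_even_coord] psign_def
        if_distrib[of "\<lambda>c. _ * c"] cong: if_cong)
  have c: "?d (thbar_ix a) * ?d (th_ix a) = ?d (th_ix a) * ?d (thbar_ix a)" for a
    by (rule even_commute) (simp add: diff_ix_def homogeneous_even_coord)
  have "ext_deriv alpha (Inl 0) =
      const \<i> * (\<Sum>a\<in>UNIV. ?d (th_ix a) * ?d (thbar_ix a)) + const \<i> * (\<Sum>a\<in>UNIV. ?d (th_ix a) * ?d (thbar_ix a))"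
    by (simp add: ext_deriv_def sum_UNIV_Plus x th thbar mult.assoc[symmetric]
        const_commute[where f = "coord B" for B, symmetric])
      (simp add: mult.assoc c sum_distrib_left)
  then show ?thesis
    by (simp add: distrib_right[symmetric] const_add[symmetric])
qed

text \<open>The contraction is linear in the even differentials, so differentiating in one of them
  isolates a single coefficient. The values of \<open>X0\<close> and \<open>X1\<close> on an odd
  coordinate have opposite parity and vanish separately.\<close>

lemma odd_coords_eq_0:
  assumes X0: "derivation 0 X0" and X1: "derivation 1 X1"
    and d: "int_deriv (\<lambda>f. X0 f + X1 f) (ext_deriv alpha) (Inl 0) = 0"
  shows "X0 (coord (Inr j)) = 0" "X1 (coord (Inr j)) = 0"
proof -
  let ?Y = "\<lambda>B. X0 (coord B) - X1 (coord B)"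
  let ?d = "\<lambda>A. coord (diff_ix A) :: (4, 2 + 2) form"
  have x: "pdiff (diff_ix (x_ix \<mu>)) (ext_deriv alpha (Inl 0)) = 0" for \<mu>
    by (simp add: ext_deriv_alpha_time diff_ix_def pdiff_sum pdiff_const_mult pdiff_coord
        pdiff_odd_mult[OF homogeneous_even_coord])
  have th: "pdiff (diff_ix (th_ix a)) (ext_deriv alpha (Inl 0)) = const (2 * \<i>) * ?d (thbar_ix a)" for a
    by (simp add: ext_deriv_alpha_time diff_ix_def pdiff_sum pdiff_const_mult pdiff_coord pdiff_even_mult
        if_distrib[of "\<lambda>c. c * _"] cong: if_cong)
  have thbar: "pdiff (diff_ix (thbar_ix a)) (ext_deriv alpha (Inl 0)) = const (2 * \<i>) * ?d (th_ix a)" for a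
    by (simp add: ext_deriv_alpha_time diff_ix_def pdiff_sum pdiff_const_mult pdiff_coord pdiff_even_mult
        if_distrib[of "\<lambda>c. _ * c"] cong: if_cong)
  have "(\<Sum>a\<in>UNIV. pull (?Y (th_ix a)) * (const (2 * \<i>) * ?d (thbar_ix a)))
      + (\<Sum>a\<in>UNIV. pull (?Y (thbar_ix a)) * (const (2 * \<i>) * ?d (th_ix a))) = 0" (is "?E = 0")
    using d by (simp add: int_deriv_eq[OF X0 X1] sum_UNIV_Plus x th thbar)
  then have E: "pdiff (diff_ix (Inr j)) ?E = 0" for j
    by simp
  have p: "pdiff (Inl (Inr j)) (pull f * (const c * h)) = pull f * (const c * pdiff (Inl (Inr j)) h)"
    for j c h and f :: "(4, 2 + 2) superfun"
    using pdiff_odd_differential_pull[of j f]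
    by (simp add: pdiff_even_mult pdiff_const_mult diff_ix_def)
  \<comment> \<open>The value on \<theta> multiplies the conjugate differential and vice versa, so
    the derivative is taken in the partner of \<open>j\<close>.\<close>
  have "pull (?Y (Inr j)) * const (2 * \<i>) = 0"
    using E[of "case j of Inl a \<Rightarrow> Inr a | Inr a \<Rightarrow> Inl a"]
    by (cases j) (simp_all add: diff_ix_def pdiff_add pdiff_sum p pdiff_coord
        if_distrib[of "\<lambda>c. _ * c"] cong: if_cong)
  \<comment> \<open>The algebra has zero divisors; the constant is removed by multiplying with its
    inverse.\<close>
  then have "pull (?Y (Inr j)) * const (2 * \<i>) * const (1 / (2 * \<i>)) = 0" by simp
  then have "pull (?Y (Inr j)) = 0" by (simp add: mult.assoc const_mult[symmetric])
  then have "?Y (Inr j) = 0" by (rule pull_eq_0D)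
  note * = homogeneous_diff_eq_0[OF derivation_homogeneousD[OF X0 homogeneous_odd_coord]
      derivation_homogeneousD[OF X1 homogeneous_odd_coord] _ this]
  show "X0 (coord (Inr j)) = 0" "X1 (coord (Inr j)) = 0"
    by (rule *; simp)+
qed

theorem theorem3p1:
  shows "form_kernel alpha = left_span (range susy_D \<union> range susy_Dbar) \<and>
    (\<forall>X\<in>form_kernel alpha. int_deriv X (ext_deriv alpha) = (\<lambda>A. 0) \<longleftrightarrow> X = (\<lambda>f. 0))"
proof (intro conjI ballI iffI)
  show "form_kernel alpha = left_span (range susy_D \<union> range susy_Dbar)"
    by (rule form_kernel_alpha_eq)
next
  fix X assume "X \<in> form_kernel alpha" and d: "int_deriv X (ext_deriv alpha) = (\<lambda>A. 0)"
  then obtain X0 X1 where X: "derivation 0 X0" "derivation 1 X1" "X = (\<lambda>f. X0 f + X1 f)"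
    and K: "\<And>\<mu>. alpha_contraction X0 \<mu> = 0" "\<And>\<mu>. alpha_contraction X1 \<mu> = 0"
    unfolding form_kernel_alpha_iff by blast
  have "int_deriv (\<lambda>f. X0 f + X1 f) (ext_deriv alpha) (Inl 0) = 0"
    using d unfolding X(3) by (rule fun_cong)
  note odd_coords_eq_0[OF X(1,2) this]
  \<comment> \<open>All coefficients in the expansion of \<open>X0\<close> and \<open>X1\<close> by
    the SUSY fields are values on odd coordinates, which vanish.\<close>
  then show "X = (\<lambda>f. 0)"
    unfolding X(3) using derivation_susy_expansion[OF X(1) K(1)] derivation_susy_expansion[OF X(2) K(2)]
    by simp
next
  fix X :: "(4, 2 + 2) operator" assume X: "X = (\<lambda>f. 0)"
  \<comment> \<open>The zero derivation has either parity, so it serves as both parts of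
    \<open>X\<close>.\<close>
  show "int_deriv X (ext_deriv alpha) = (\<lambda>A. 0)"
    unfolding X using int_deriv_eq[OF derivation_zero derivation_zero, of "ext_deriv alpha"]
    by (simp add: fun_eq_iff)
qed

end
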